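(* Let $A\in\mathbb{R}^{n\times d}$, let $\epsilon\in(0,1)$, and let $\nu=\epsilon/d$. Let $I^\ast=\{i:\tau_i(A)\ge\nu\}$ and let $I\supseteq I^\ast$ be a known set of row indices. Suppose that $m\ge C\,(d/\epsilon^2)(\mathrm{polylog}(1/\epsilon)+\log(1/\delta))$, $\delta\in(0,1/m]$ and $d\ge C\,(1/\epsilon)\,\mathrm{polylog}(1/\epsilon)\log^2(1/\delta)$ for a sufficiently large absolute constant $C$. Then there exists a distribution on matrices $S$ which, after permuting the rows of $A$ so that $A=\begin{pmatrix}A_I\\ A_{I^c}\end{pmatrix}$, have the form $S=\begin{pmatrix} I & 0\\ 0 & S'\end{pmatrix}$ with $S'$ a CountSketch matrix with $m$ rows (so $S$ has $m+|I|$ rows), such that $$\Pr\left\{\exists x\in\mathrm{col}(A):\ \big|\|Sx\|_2^2-\|x\|_2^2\big|>\epsilon\|x\|_2^2\right\}\le\delta.$$ In particular, when $\delta=1/m$, the sketching matrix $S$ has $O((d/\epsilon^2)\,\mathrm{polylog}(d/\epsilon))$ rows.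
   Context: $\tau_i(A)$ denotes the (ordinary) leverage score of the $i$-th row of $A$, i.e., the $i$-th diagonal entry of the orthogonal projection onto the column space $\mathrm{col}(A)$. A CountSketch matrix $S'\in\mathbb{R}^{m\times N}$ has exactly one non-zero entry in each column, located in a uniformly random row and equal to a uniformly random sign $\pm1$, independently across columns. $\mathrm{col}(A)$ is the column space of $A$. *)

theory Defs
  imports "HOL-Probability.Probability"
begin

text \<open>Matrices are rendered with explicit dimensions: A :: nat => nat => real,
  entries A i j meaningful for i < n, j < d. Vectors in R^n are functions nat => real,
  only the coordinates 0..<n are relevant (others are fixed to 0).\<close>

definition colspace :: "nat \<Rightarrow> nat \<Rightarrow> (nat \<Rightarrow> nat \<Rightarrow> real) \<Rightarrow> (nat \<Rightarrow> real) set" where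
  "colspace n d A = {x. \<exists>c :: nat \<Rightarrow> real.
      \<forall>i. x i = (if i < n then (\<Sum>j<d. A i j * c j) else 0)}"

definition inner_n :: "nat \<Rightarrow> (nat \<Rightarrow> real) \<Rightarrow> (nat \<Rightarrow> real) \<Rightarrow> real" where
  "inner_n n x y = (\<Sum>i<n. x i * y i)"

definition sqnorm_n :: "nat \<Rightarrow> (nat \<Rightarrow> real) \<Rightarrow> real" where
  "sqnorm_n n x = (\<Sum>i<n. (x i)\<^sup>2)"

definition orth_proj_col :: "nat \<Rightarrow> nat \<Rightarrow> (nat \<Rightarrow> nat \<Rightarrow> real) \<Rightarrow> (nat \<Rightarrow> real) \<Rightarrow> (nat \<Rightarrow> real)" where
  "orth_proj_col n d A x = (THE p. p \<in> colspace n d A \<and>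
      (\<forall>y \<in> colspace n d A. inner_n n (\<lambda>i. x i - p i) y = 0))"

definition leverage :: "nat \<Rightarrow> nat \<Rightarrow> (nat \<Rightarrow> nat \<Rightarrow> real) \<Rightarrow> nat \<Rightarrow> real" where
  "leverage n d A i = orth_proj_col n d A (\<lambda>k. if k = i then 1 else 0) i"

text \<open>CountSketch randomness on the columns J = {0..<n} - I: a hash h : J -> {0..<m}
  and a sign sigma : J -> {-1,1}, all independent and uniform (uniform on the product set).\<close>
definition cs_space :: "nat \<Rightarrow> nat set \<Rightarrow> nat \<Rightarrow> ((nat \<Rightarrow> nat) \<times> (nat \<Rightarrow> real)) set" where
  "cs_space n I m = (PiE ({0..<n} - I) (\<lambda>_. {0..<m})) \<times> (PiE ({0..<n} - I) (\<lambda>_. {-1, 1}))"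

definition countsketch_pmf :: "nat \<Rightarrow> nat set \<Rightarrow> nat \<Rightarrow> ((nat \<Rightarrow> nat) \<times> (nat \<Rightarrow> real)) pmf" where
  "countsketch_pmf n I m = pmf_of_set (cs_space n I m)"

definition cs_mat :: "(nat \<Rightarrow> nat) \<Rightarrow> (nat \<Rightarrow> real) \<Rightarrow> nat \<Rightarrow> nat \<Rightarrow> real" where
  "cs_mat h \<sigma> r j = (if h j = r then \<sigma> j else 0)"

text \<open>S x, where S = [[Id_I, 0],[0, S']] (after permuting rows of A so that I comes first).
  Rows 0..<card I copy the coordinates in I (in increasing order); rows card I + r, r < m,
  are row r of S' applied to the coordinates in J.\<close>
definition sketch_apply :: "nat \<Rightarrow> nat set \<Rightarrow> nat \<Rightarrow> ((nat \<Rightarrow> nat) \<times> (nat \<Rightarrow> real)) \<Rightarrow> (nat \<Rightarrow> real) \<Rightarrow> (nat \<Rightarrow> real)" where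
  "sketch_apply n I m \<omega> x = (\<lambda>k.
     if k < card I then x (sorted_list_of_set I ! k)
     else if k < card I + m then
       (\<Sum>j \<in> {0..<n} - I. cs_mat (fst \<omega>) (snd \<omega>) (k - card I) j * x j)
     else 0)"

end

(* Write the rows of an orthonormal basis of col(A) as u_i, so that |u_i|^2 is the leverage score.
   The distortion on col(A) is the quadratic form sum_r (v_r v_r^T - W_r), where v_r is the signed sum
   and W_r the sum of u_i u_i^T over the columns hashed to row r. A scalar Chernoff bound over the hash
   gives tr W_r <= w, of order eps^2 / log(1/delta), for all r. Conditionally on the hash the v_r are
   independent, and a matrix Bernstein bound applies, with sub-exponential control of |v_r|^2 at scale w.
   It is proved by a trace-exponential supermartingale: Klein's inequality linearises tr exp around the
   compensated matrix, and a comparison of two spectral decompositions shows that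
   v^T exp(A + c v v^T) v exceeds v^T exp(A) v by at most the factor exp(2 c |v|^2). The
   dimensional prefactor d is absorbed because delta <= 1/m <= 1/d. *)

theory Submission
  imports Defs
begin

subsection \<open>Orthonormal systems and the spectral theorem\<close>

text \<open>Given the hash, |v_r|^2 has mean tr W_r, but for unlucky signs it can be larger by a
  factor up to the number of columns in the bucket, so a matrix Bernstein inequality for bounded
  summands gives too little. Klein's inequality bounds tr exp(A + c v v^T) by a term whose
  exponential sits at the perturbed, sign-dependent matrix. Moving it back to A costs the weight
  exp(2 c |v|^2), and averaging this weight over the signs costs only a relative error O(c w) in the
  second moment, uniformly in the direction. The compensator is subtracted before the random term is
  added, so that both linearisations are based at the same A and cancel. The two size hypotheses
  have separate sources. The sign tail exp(-eps^2/(1280 w)) forces w to be of order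
  eps^2/log(1/delta). The Chernoff bound over the hash, with single loads at most eps/d, then asks
  that w d/eps dominate log(1/delta), which is the condition on d, and that the mean load, at most
  d/m, be a fraction of w, which is the condition on m.\<close>

lemma inner_n_commute: "inner_n r x y = inner_n r y x"
  by (simp add: inner_n_def mult.commute)

lemma inner_n_cong:
  assumes "\<And>i. i < r \<Longrightarrow> x i = x' i" "\<And>i. i < r \<Longrightarrow> y i = y' i"
  shows "inner_n r x y = inner_n r x' y'"
  unfolding inner_n_def by (rule sum.cong) (use assms in auto)

lemma inner_n_add_right: "inner_n r x (\<lambda>i. y i + z i) = inner_n r x y + inner_n r x z"
  by (simp add: inner_n_def sum.distrib algebra_simps)

lemma inner_n_diff_right: "inner_n r x (\<lambda>i. y i - z i) = inner_n r x y - inner_n r x z"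
  by (simp add: inner_n_def sum_subtractf algebra_simps)

lemma inner_n_scale_right: "inner_n r x (\<lambda>i. c * y i) = c * inner_n r x y"
  by (simp add: inner_n_def sum_distrib_left algebra_simps)

lemma inner_n_sum_right: "inner_n r x (\<lambda>i. \<Sum>k\<in>F. f k i) = (\<Sum>k\<in>F. inner_n r x (f k))"
  unfolding inner_n_def sum_distrib_left by (rule sum.swap)

lemma inner_n_add_left: "inner_n r (\<lambda>i. y i + z i) x = inner_n r y x + inner_n r z x"
  by (simp add: inner_n_commute[of _ _ x] inner_n_add_right)

lemma inner_n_diff_left: "inner_n r (\<lambda>i. y i - z i) x = inner_n r y x - inner_n r z x"
  by (simp add: inner_n_commute[of _ _ x] inner_n_diff_right)

lemma inner_n_scale_left: "inner_n r (\<lambda>i. c * y i) x = c * inner_n r y x"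
  by (simp add: inner_n_commute[of _ _ x] inner_n_scale_right)

lemma inner_n_sum_left: "inner_n r (\<lambda>i. \<Sum>k\<in>F. f k i) x = (\<Sum>k\<in>F. inner_n r (f k) x)"
  by (simp add: inner_n_commute[of _ _ x] inner_n_sum_right)

lemmas inner_n_linear =
  inner_n_add_right inner_n_diff_right inner_n_scale_right inner_n_sum_right
  inner_n_add_left inner_n_diff_left inner_n_scale_left inner_n_sum_left

lemma inner_n_nonneg: "0 \<le> inner_n r x x"
  by (simp add: inner_n_def sum_nonneg)

lemma inner_n_eq_0_iff: "inner_n r x x = 0 \<longleftrightarrow> (\<forall>i<r. x i = 0)"
  unfolding inner_n_def by (subst sum_nonneg_eq_0_iff) auto

lemma inner_n_Cauchy_Schwarz: "(inner_n r x y)\<^sup>2 \<le> inner_n r x x * inner_n r y y"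
  using Cauchy_Schwarz_ineq_sum[of x y "{..<r}"] by (simp add: inner_n_def power2_eq_square)

lemma inner_n_delta_left:
  assumes "i < r"
  shows "inner_n r (\<lambda>k. if k = i then 1 else 0) x = x i"
  using assms unfolding inner_n_def by (subst sum.remove[of _ i]) auto

lemma inner_n_delta_right:
  assumes "i < r"
  shows "inner_n r x (\<lambda>k. if k = i then 1 else 0) = x i"
  using inner_n_delta_left[OF assms] by (simp add: inner_n_commute)

definition orthonormal :: "nat \<Rightarrow> nat \<Rightarrow> (nat \<Rightarrow> nat \<Rightarrow> real) \<Rightarrow> bool" where
  "orthonormal r s q \<longleftrightarrow> (\<forall>k<s. \<forall>j<s. inner_n r (q k) (q j) = (if k = j then 1 else 0))"

lemma orthonormalD:
  "orthonormal r s q \<Longrightarrow> k < s \<Longrightarrow> j < s \<Longrightarrow> inner_n r (q k) (q j) = (if k = j then 1 else 0)"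
  by (simp add: orthonormal_def)

lemma orthonormal_comb:
  assumes "orthonormal r s q" "k < s"
  shows "inner_n r (q k) (\<lambda>i. \<Sum>j<s. c j * q j i) = c k"
proof -
  have "inner_n r (q k) (\<lambda>i. \<Sum>j<s. c j * q j i) = (\<Sum>j<s. if j = k then c j else 0)"
    unfolding inner_n_linear using assms by (intro sum.cong) (auto simp: orthonormalD)
  then show ?thesis using assms by simp
qed

definition residual :: "nat \<Rightarrow> nat \<Rightarrow> (nat \<Rightarrow> nat \<Rightarrow> real) \<Rightarrow> (nat \<Rightarrow> real) \<Rightarrow> nat \<Rightarrow> real" where
  "residual r s q x = (\<lambda>i. x i - (\<Sum>k<s. inner_n r (q k) x * q k i))"

lemma residual_orthogonal:
  assumes "orthonormal r s q" "k < s"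
  shows "inner_n r (q k) (residual r s q x) = 0"
  unfolding residual_def inner_n_diff_right orthonormal_comb[OF assms] by simp

lemma residual_sqnorm:
  assumes "orthonormal r s q"
  shows "inner_n r (residual r s q x) (residual r s q x)
    = inner_n r x x - (\<Sum>k<s. (inner_n r (q k) x)\<^sup>2)"
proof -
  let ?z = "residual r s q x"
  have "inner_n r ?z ?z = inner_n r ?z x - (\<Sum>k<s. inner_n r (q k) x * inner_n r ?z (q k))"
    by (subst (2) residual_def) (simp add: inner_n_linear)
  also have "(\<Sum>k<s. inner_n r (q k) x * inner_n r ?z (q k)) = 0"
    using residual_orthogonal[OF assms] by (simp add: inner_n_commute[of r ?z])
  also have "inner_n r ?z x = inner_n r x x - (\<Sum>k<s. (inner_n r (q k) x)\<^sup>2)"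
    by (simp add: residual_def inner_n_linear power2_eq_square)
  finally show ?thesis by simp
qed

text \<open>The trace of the projection onto the span, read off its diagonal. It replaces all
  dimension counts: it yields vectors orthogonal to an incomplete system, the completeness of a
  system of size r, and the bound on the total leverage.\<close>

lemma sum_sq_orthonormal:
  assumes "orthonormal r s q"
  shows "(\<Sum>i<r. \<Sum>k<s. (q k i)\<^sup>2) = real s"
proof -
  have "(\<Sum>i<r. \<Sum>k<s. (q k i)\<^sup>2) = (\<Sum>k<s. inner_n r (q k) (q k))"
    unfolding inner_n_def power2_eq_square by (rule sum.swap)
  also have "\<dots> = real s"
    using assms by (simp add: orthonormalD)
  finally show ?thesis .
qed

text \<open>If every standard basis vector had zero residual, all diagonal entries of the projection
  would be 1 and its trace would be r instead of s. Coordinates from r on are set to 0 so that the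
  vector lies in the compact set used for the Rayleigh quotient.\<close>

lemma exists_unit_orthogonal:
  assumes q: "orthonormal r s q" and "s < r"
  shows "\<exists>x. (\<forall>i\<ge>r. x i = 0) \<and> inner_n r x x = 1 \<and> (\<forall>k<s. inner_n r (q k) x = 0)"
proof -
  define e where "e i = (\<lambda>k::nat. if k = i then 1 else 0 :: real)" for i
  have "\<exists>i<r. inner_n r (residual r s q (e i)) (residual r s q (e i)) \<noteq> 0"
  proof (rule ccontr)
    assume "\<not> ?thesis"
    then have "(\<Sum>k<s. (q k i)\<^sup>2) = 1" if "i < r" for i
      using that residual_sqnorm[OF q, of "e i"] by (simp add: e_def inner_n_delta_right)
    then have "(\<Sum>i<r. \<Sum>k<s. (q k i)\<^sup>2) = real r" by simp
    then show False using sum_sq_orthonormal[OF q] \<open>s < r\<close> by simp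
  qed
  then obtain i where i: "i < r" and nz: "inner_n r (residual r s q (e i)) (residual r s q (e i)) \<noteq> 0"
    by blast
  define z where "z = residual r s q (e i)"
  define N where "N = sqrt (inner_n r z z)"
  have N: "N > 0" "N * N = inner_n r z z"
    using nz inner_n_nonneg[of r z] by (auto simp: N_def z_def less_le)
  define x where "x j = (if j < r then inverse N * z j else 0)" for j
  have *: "inner_n r y x = inverse N * inner_n r y z" for y
    using inner_n_cong[of r y y x "\<lambda>j. inverse N * z j"] by (simp add: x_def inner_n_linear)
  have "inner_n r x x = 1"
    using N(1) by (simp add: * inner_n_commute[of r x z] N(2)[symmetric] field_simps)
  moreover have "inner_n r (q k) x = 0" if "k < s" for k
    using residual_orthogonal[OF q that] by (simp add: * z_def)
  ultimately show ?thesis by (intro exI[of _ x]) (simp add: x_def)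
qed

text \<open>Completeness by a trace count: the squared residuals of the standard basis vectors are
  nonnegative and sum to r - r = 0, so each of them vanishes.\<close>

lemma parseval:
  assumes q: "orthonormal r r q"
  shows "(\<Sum>k<r. inner_n r (q k) x * inner_n r (q k) y) = inner_n r x y"
proof -
  have z: "inner_n r (residual r r q x) (residual r r q x) = 0" for x
  proof -
    define e where "e i = (\<lambda>k::nat. if k = i then 1 else 0 :: real)" for i
    define g where "g i = inner_n r (residual r r q (e i)) (residual r r q (e i))" for i
    have g: "g i = 1 - (\<Sum>k<r. (q k i)\<^sup>2)" if "i < r" for i
      using that residual_sqnorm[OF q, of "e i"] by (simp add: g_def e_def inner_n_delta_right)
    have "(\<Sum>i<r. g i) = 0"
      using sum_sq_orthonormal[OF q] g by (simp add: sum_subtractf)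
    then have g0: "g i = 0" if "i < r" for i
      using that by (subst (asm) sum_nonneg_eq_0_iff) (auto simp: g_def inner_n_nonneg)
    have e: "e i j = (\<Sum>k<r. q k i * q k j)" if "i < r" "j < r" for i j
      using g0[OF that(1)] that unfolding g_def inner_n_eq_0_iff
      by (auto simp: residual_def e_def inner_n_delta_right)
    have "residual r r q x j = 0" if j: "j < r" for j
    proof -
      have "(\<Sum>k<r. inner_n r (q k) x * q k j) = (\<Sum>k<r. \<Sum>i<r. x i * (q k i * q k j))"
        unfolding inner_n_def sum_distrib_right by (simp add: mult_ac)
      also have "\<dots> = (\<Sum>i<r. x i * e i j)"
        by (subst sum.swap) (simp add: e j sum_distrib_left)
      also have "\<dots> = x j"
        using j by (simp add: e_def if_distrib sum.delta cong: if_cong)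
      finally show ?thesis by (simp add: residual_def)
    qed
    then show ?thesis by (simp add: inner_n_eq_0_iff)
  qed
  have "inner_n r x y = inner_n r (\<lambda>i. \<Sum>k<r. inner_n r (q k) x * q k i) y"
    using z[of x] by (intro inner_n_cong) (auto simp: inner_n_eq_0_iff residual_def)
  then show ?thesis by (simp add: inner_n_linear)
qed

section \<open>The spectral theorem by maximising the Rayleigh quotient\<close>

definition mv :: "nat \<Rightarrow> (nat \<Rightarrow> nat \<Rightarrow> real) \<Rightarrow> (nat \<Rightarrow> real) \<Rightarrow> nat \<Rightarrow> real" where
  "mv r A x = (\<lambda>i. \<Sum>j<r. A i j * x j)"

lemma mv_symmetric:
  assumes "\<And>i j. A i j = A j i"
  shows "inner_n r x (mv r A y) = inner_n r y (mv r A x)"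
proof -
  have "inner_n r x (mv r A y) = (\<Sum>i<r. \<Sum>j<r. x i * (A i j * y j))"
    by (simp add: inner_n_def mv_def sum_distrib_left)
  also have "\<dots> = (\<Sum>j<r. \<Sum>i<r. x i * (A i j * y j))" by (rule sum.swap)
  also have "\<dots> = inner_n r y (mv r A x)"
    unfolding inner_n_def mv_def sum_distrib_left
    by (intro sum.cong refl) (metis assms mult.commute mult.left_commute)
  finally show ?thesis .
qed

lemma mv_linear:
  "mv r A (\<lambda>i. x i + c * y i) = (\<lambda>i. mv r A x i + c * mv r A y i)"
  by (simp add: mv_def sum.distrib sum_distrib_left algebra_simps fun_eq_iff)

text \<open>Vectors are functions on all natural numbers, so compactness refers to the product
  topology: Tychonoff's theorem applies to a box whose factors from r on are the singleton of 0, and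
  the remaining conditions are closed.\<close>

lemma compact_unit_orthogonal:
  "compact {x::nat \<Rightarrow> real. (\<forall>i\<ge>r. x i = 0) \<and> inner_n r x x = 1 \<and> (\<forall>k<s. inner_n r (q k) x = 0)}"
    (is "compact ?V")
proof -
  let ?B = "PiE UNIV (\<lambda>i. if i < r then {-1..1} else {0::real})"
  have "compactin (product_topology (\<lambda>_. euclidean) UNIV) ?B"
    by (subst compactin_PiE) auto
  then have B: "compact ?B"
    by (simp add: euclidean_product_topology compactin_euclidean_iff)
  have cont: "continuous_on UNIV (\<lambda>x::nat \<Rightarrow> real. x i)" for i
    by (rule continuous_on_product_coordinates)
  have ci: "continuous_on UNIV (\<lambda>x. inner_n r x x)" "continuous_on UNIV (\<lambda>x. inner_n r y x)" for y
    unfolding inner_n_def by (intro continuous_intros cont)+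
  have "closed ({x. inner_n r x x = 1} \<inter> (\<Inter>k\<in>{..<s}. {x. inner_n r (q k) x = 0}))"
    by (intro closed_Int closed_INT ballI closed_Collect_eq ci continuous_on_const)
  then have "compact (?B \<inter> ({x. inner_n r x x = 1} \<inter> (\<Inter>k\<in>{..<s}. {x. inner_n r (q k) x = 0})))"
    by (rule compact_Int_closed[OF B])
  also have "?B \<inter> ({x. inner_n r x x = 1} \<inter> (\<Inter>k\<in>{..<s}. {x. inner_n r (q k) x = 0})) = ?V"
  proof -
    have "x i \<in> {-1..1}" if "inner_n r x x = 1" "i < r" for x i
    proof -
      have "(x i)\<^sup>2 \<le> inner_n r x x"
        unfolding inner_n_def power2_eq_square
        using that by (intro member_le_sum) auto
      then show ?thesis using that by (auto simp: abs_square_le_1 abs_le_iff)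
    qed
    then show ?thesis by (auto simp: PiE_def Pi_def split: if_splits)
  qed
  finally show ?thesis .
qed

text \<open>The new eigenvector maximises the quadratic form on the unit sphere of the complement of
  the \<open>q k\<close>. By symmetry the complement is invariant under \<open>A\<close>, so y = A x
  - \<mu> x lies in it as well, and it is orthogonal to x; maximality forces it to vanish.\<close>

lemma extend_eigenvectors:
  assumes sym: "\<And>i j. A i j = A j i"
    and q: "orthonormal r s q" and "s < r"
    and ev: "\<And>k i. k < s \<Longrightarrow> i < r \<Longrightarrow> mv r A (q k) i = l k * q k i"
  shows "\<exists>x \<mu>. inner_n r x x = 1 \<and> (\<forall>k<s. inner_n r (q k) x = 0) \<and> (\<forall>i<r. mv r A x i = \<mu> * x i)"
proof -
  let ?V = "{x. (\<forall>i\<ge>r. x i = 0) \<and> inner_n r x x = 1 \<and> (\<forall>k<s. inner_n r (q k) x = 0)}"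
  have cont: "continuous_on ?V (\<lambda>x. inner_n r x (mv r A x))"
    unfolding inner_n_def mv_def
    by (intro continuous_intros continuous_on_subset[OF continuous_on_product_coordinates]) auto
  obtain x where x: "x \<in> ?V" and max: "\<forall>y\<in>?V. inner_n r y (mv r A y) \<le> inner_n r x (mv r A x)"
    using continuous_attains_sup[OF compact_unit_orthogonal _ cont] exists_unit_orthogonal[OF q \<open>s < r\<close>]
    by blast
  define \<mu> where "\<mu> = inner_n r x (mv r A x)"
  have bound: "inner_n r y (mv r A y) \<le> \<mu> * inner_n r y y" if y: "\<forall>k<s. inner_n r (q k) y = 0" for y
  proof (cases "inner_n r y y = 0")
    case True
    then have "inner_n r y (mv r A y) = 0"
      by (simp add: inner_n_eq_0_iff) (simp add: inner_n_def)
    then show ?thesis by (simp add: True)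
  next
    case False
    define N where "N = sqrt (inner_n r y y)"
    have N: "N > 0" "inner_n r y y = N\<^sup>2"
      using False inner_n_nonneg[of r y] by (auto simp: N_def less_le)
    define y' where "y' j = (if j < r then inverse N * y j else 0)" for j
    have *: "inner_n r z y' = inverse N * inner_n r z y" for z
      using inner_n_cong[of r z z y' "\<lambda>j. inverse N * y j"] by (simp add: y'_def inner_n_linear)
    have m: "mv r A y' = (\<lambda>i. inverse N * mv r A y i)"
      by (simp add: mv_def y'_def sum_distrib_left algebra_simps fun_eq_iff)
    have "inner_n r y' y' = 1"
      using N by (simp add: * inner_n_commute[of r y' y] power2_eq_square field_simps)
    then have "y' \<in> ?V" using y by (simp add: *) (simp add: y'_def)
    then have "inner_n r y' (mv r A y') \<le> \<mu>" using max by (simp add: \<mu>_def)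
    also have "inner_n r y' (mv r A y') = inverse N * (inverse N * inner_n r y (mv r A y))"
      by (simp add: m inner_n_scale_right inner_n_commute[of r y'] *) (simp add: inner_n_commute)
    finally have "inner_n r y (mv r A y) / N\<^sup>2 \<le> \<mu>"
      by (simp add: field_simps power2_eq_square)
    then show ?thesis using N by (simp add: field_simps)
  qed
  define y where "y = (\<lambda>i. mv r A x i + (-\<mu>) * x i)"
  have xq: "inner_n r (q k) x = 0" if "k < s" for k using x that by simp
  have xx: "inner_n r x x = 1" using x by simp
  have yq: "inner_n r (q k) y = 0" if "k < s" for k
  proof -
    have "inner_n r (q k) (mv r A x) = inner_n r x (mv r A (q k))" by (rule mv_symmetric[OF sym])
    also have "\<dots> = inner_n r x (\<lambda>i. l k * q k i)" using ev[OF that] by (intro inner_n_cong) auto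
    also have "\<dots> = 0" using xq[OF that] by (simp add: inner_n_linear inner_n_commute)
    finally show ?thesis using xq[OF that] by (simp add: y_def inner_n_linear)
  qed
  have xy: "inner_n r x y = 0"
    unfolding y_def inner_n_linear by (simp add: xx \<mu>_def)
  have yAx: "inner_n r y (mv r A x) = inner_n r y y"
  proof -
    have "inner_n r y y = inner_n r y (mv r A x) - \<mu> * inner_n r y x"
      by (subst (2) y_def) (unfold inner_n_add_right inner_n_scale_right, simp)
    then show ?thesis using xy by (simp add: inner_n_commute)
  qed
  define a where "a = inner_n r y y"
  define b where "b = inner_n r y (mv r A y)"
  \<comment> \<open>The perturbation x + t y cannot increase the Rayleigh quotient to first order.\<close>
  have pert: "2 * t * a + t\<^sup>2 * b \<le> \<mu> * t\<^sup>2 * a" for t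
  proof -
    have "inner_n r (\<lambda>i. x i + t * y i) (mv r A (\<lambda>i. x i + t * y i))
        \<le> \<mu> * inner_n r (\<lambda>i. x i + t * y i) (\<lambda>i. x i + t * y i)"
      by (rule bound) (use xq yq in \<open>simp add: inner_n_linear\<close>)
    moreover have "inner_n r x (mv r A y) = a"
      using mv_symmetric[OF sym, where r=r and x=x and y=y] yAx by (simp add: a_def)
    ultimately show ?thesis
      using xy xx yAx
      unfolding mv_linear inner_n_add_right inner_n_add_left inner_n_scale_right inner_n_scale_left inner_n_commute[of r y x]
        a_def[symmetric] b_def[symmetric] \<mu>_def[symmetric] xy xx yAx
      by (simp add: power2_eq_square algebra_simps)
  qed
  have "a = 0"
  proof (rule ccontr)
    assume "a \<noteq> 0"
    then have a: "a > 0" using inner_n_nonneg[of r y] by (simp add: a_def less_le)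
    \<comment> \<open>Any positive c above \<mu> a - b serves: at t = a/c the linear gain 2 t a is
      twice the bound t^2 c on the quadratic loss.\<close>
    define c where "c = \<bar>\<mu> * a - b\<bar> + 1"
    have c: "c > 0" "\<mu> * a - b \<le> c" by (auto simp: c_def)
    have "2 * (a / c) * a \<le> (a/c)\<^sup>2 * (\<mu> * a - b)"
      using pert[of "a/c"] by (simp add: algebra_simps)
    also have "\<dots> \<le> (a/c)\<^sup>2 * c" using c by (intro mult_left_mono) auto
    also have "\<dots> = (a/c) * a" using c by (simp add: power2_eq_square)
    finally have "(a/c) * a \<le> 0" by simp
    moreover have "(a/c) * a > 0" using a c by simp
    ultimately show False by simp
  qed
  then have "\<forall>i<r. mv r A x i = \<mu> * x i"
    by (simp add: a_def inner_n_eq_0_iff y_def)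
  then show ?thesis using xx xq by blast
qed

definition spectral :: "nat \<Rightarrow> (nat \<Rightarrow> nat \<Rightarrow> real) \<Rightarrow> (nat \<Rightarrow> nat \<Rightarrow> real) \<Rightarrow> (nat \<Rightarrow> real) \<Rightarrow> bool" where
  "spectral r A q l \<longleftrightarrow> orthonormal r r q \<and> (\<forall>k<r. \<forall>i<r. mv r A (q k) i = l k * q k i)"

lemma spectral_exists:
  assumes sym: "\<And>i j. A i j = A j i"
  shows "\<exists>q l. spectral r A q l"
proof -
  have "\<exists>q l. orthonormal r s q \<and> (\<forall>k<s. \<forall>i<r. mv r A (q k) i = l k * q k i)" if "s \<le> r" for s
    using that
  proof (induction s)
    case 0
    show ?case by (simp add: orthonormal_def)
  next
    case (Suc s)
    then obtain q l where q: "orthonormal r s q"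
      and ev: "\<And>k i. k < s \<Longrightarrow> i < r \<Longrightarrow> mv r A (q k) i = l k * q k i" by auto
    obtain x \<mu> where x: "inner_n r x x = 1" "\<forall>k<s. inner_n r (q k) x = 0" "\<forall>i<r. mv r A x i = \<mu> * x i"
      using extend_eigenvectors[OF sym q _ ev] Suc.prems by auto
    have "inner_n r x (q k) = 0" if "k < s" for k
      using x(2) that by (subst inner_n_commute) simp
    then have "orthonormal r (Suc s) (q(s := x))"
      using q x unfolding orthonormal_def by (auto simp: less_Suc_eq)
    moreover have "\<forall>k<Suc s. \<forall>i<r. mv r A ((q(s := x)) k) i = (l(s := \<mu>)) k * (q(s := x)) k i"
      using ev x by (auto simp: less_Suc_eq)
    ultimately show ?case by blast
  qed
  from this[of r] show ?thesis unfolding spectral_def by auto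
qed

subsection \<open>Trace exponentials under rank-one perturbations\<close>

text \<open>For symmetric A, trexp is tr (exp A) and expform is the quadratic form of exp A; the chosen
  decomposition, and hence both, are junk otherwise.\<close>

definition eigvec :: "nat \<Rightarrow> (nat \<Rightarrow> nat \<Rightarrow> real) \<Rightarrow> nat \<Rightarrow> nat \<Rightarrow> real" where
  "eigvec r A = fst (SOME (q, l). spectral r A q l)"

definition eigval :: "nat \<Rightarrow> (nat \<Rightarrow> nat \<Rightarrow> real) \<Rightarrow> nat \<Rightarrow> real" where
  "eigval r A = snd (SOME (q, l). spectral r A q l)"

definition trexp :: "nat \<Rightarrow> (nat \<Rightarrow> nat \<Rightarrow> real) \<Rightarrow> real" where
  "trexp r A = (\<Sum>k<r. exp (eigval r A k))"

definition expform :: "nat \<Rightarrow> (nat \<Rightarrow> nat \<Rightarrow> real) \<Rightarrow> (nat \<Rightarrow> real) \<Rightarrow> real" where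
  "expform r A v = (\<Sum>k<r. exp (eigval r A k) * (inner_n r (eigvec r A k) v)\<^sup>2)"

definition symm :: "(nat \<Rightarrow> nat \<Rightarrow> real) \<Rightarrow> bool" where
  "symm A \<longleftrightarrow> (\<forall>i j. A i j = A j i)"

lemma spectral_eig:
  assumes "symm A"
  shows "spectral r A (eigvec r A) (eigval r A)"
proof -
  have "\<exists>p. case p of (q, l) \<Rightarrow> spectral r A q l"
    using spectral_exists[of A r] assms by (auto simp: symm_def)
  then have "case (SOME (q, l). spectral r A q l) of (q, l) \<Rightarrow> spectral r A q l"
    by (rule someI_ex)
  then show ?thesis
    unfolding eigvec_def eigval_def by (simp add: case_prod_unfold)
qed

lemma eigvec_orthonormal: "symm A \<Longrightarrow> orthonormal r r (eigvec r A)"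
  using spectral_eig[of A r] by (simp add: spectral_def)

lemma inner_mv_eigvec:
  assumes "symm A" "k < r"
  shows "inner_n r x (mv r A (eigvec r A k)) = eigval r A k * inner_n r x (eigvec r A k)"
proof -
  have "inner_n r x (mv r A (eigvec r A k)) = inner_n r x (\<lambda>i. eigval r A k * eigvec r A k i)"
    using spectral_eig[OF assms(1), of r] assms(2) by (intro inner_n_cong) (auto simp: spectral_def)
  then show ?thesis by (simp add: inner_n_linear)
qed

lemma parseval_eigvec:
  "symm A \<Longrightarrow> (\<Sum>k<r. (inner_n r (eigvec r A k) x)\<^sup>2) = inner_n r x x"
  using parseval[OF eigvec_orthonormal, of A r x x] by (simp add: power2_eq_square)

lemma inner_eigvec_self: "symm A \<Longrightarrow> k < r \<Longrightarrow> inner_n r (eigvec r A k) (eigvec r A k) = 1"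
  using eigvec_orthonormal[of A r] by (simp add: orthonormalD)

lemma quadform_spectral:
  assumes "symm A"
  shows "inner_n r x (mv r A x) = (\<Sum>k<r. eigval r A k * (inner_n r (eigvec r A k) x)\<^sup>2)"
proof -
  have "inner_n r x (mv r A x)
      = (\<Sum>k<r. inner_n r (eigvec r A k) x * inner_n r (eigvec r A k) (mv r A x))"
    by (rule parseval[OF eigvec_orthonormal[OF assms], symmetric])
  also have "\<dots> = (\<Sum>k<r. eigval r A k * (inner_n r (eigvec r A k) x)\<^sup>2)"
  proof (rule sum.cong)
    fix k assume "k \<in> {..<r}"
    then have "inner_n r (eigvec r A k) (mv r A x) = eigval r A k * inner_n r (eigvec r A k) x"
      using inner_mv_eigvec[OF assms, of k r x] mv_symmetric[of A r "eigvec r A k" x] assms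
      by (simp add: symm_def inner_n_commute)
    then show "inner_n r (eigvec r A k) x * inner_n r (eigvec r A k) (mv r A x)
        = eigval r A k * (inner_n r (eigvec r A k) x)\<^sup>2" by (simp add: power2_eq_square)
  qed simp
  finally show ?thesis .
qed

lemma expform_nonneg: "0 \<le> expform r A v"
  by (simp add: expform_def sum_nonneg)

section \<open>Klein's inequality\<close>

lemma exp_tangent: "exp m * (1 + x - m) \<le> exp (x::real)"
proof -
  have "exp m * (1 + (x - m)) \<le> exp m * exp (x - m)"
    by (intro mult_left_mono exp_ge_add_one_self) simp
  then show ?thesis by (simp add: exp_add[symmetric] add_diff_eq)
qed

text \<open>The left side is tr (exp A (1 + B - A)), evaluated in the eigenbasis of
  \<open>A\<close>. The squared inner products \<open>p k j\<close> of the two eigenbases form a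
  doubly stochastic matrix: unit row sums turn the left side into an average of tangent lines of
  exp, and unit column sums collapse the resulting bound to \<open>trexp r B\<close>.\<close>

lemma klein:
  assumes A: "symm A" and B: "symm B"
  shows "(\<Sum>k<r. exp (eigval r A k) *
      (1 + inner_n r (eigvec r A k) (mv r B (eigvec r A k)) - eigval r A k)) \<le> trexp r B"
proof -
  define p where "p k j = (inner_n r (eigvec r B j) (eigvec r A k))\<^sup>2" for k j
  have row: "(\<Sum>j<r. p k j) = 1" if "k < r" for k
    using parseval_eigvec[OF B, of r "eigvec r A k"] that by (simp add: p_def inner_eigvec_self A)
  have col: "(\<Sum>k<r. p k j) = 1" if "j < r" for j
    using parseval_eigvec[OF A, of r "eigvec r B j"] that
    by (simp add: p_def inner_eigvec_self B inner_n_commute)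
  have "(\<Sum>k<r. exp (eigval r A k) *
      (1 + inner_n r (eigvec r A k) (mv r B (eigvec r A k)) - eigval r A k))
    = (\<Sum>k<r. \<Sum>j<r. p k j * (exp (eigval r A k) * (1 + eigval r B j - eigval r A k)))"
  proof (rule sum.cong)
    fix k assume k: "k \<in> {..<r}"
    have "(\<Sum>j<r. p k j * (exp (eigval r A k) * (1 + eigval r B j - eigval r A k)))
      = exp (eigval r A k) * ((\<Sum>j<r. p k j) * (1 - eigval r A k) + (\<Sum>j<r. eigval r B j * p k j))"
      by (simp add: sum_distrib_left sum_distrib_right sum.distrib[symmetric] algebra_simps)
    also have "(\<Sum>j<r. eigval r B j * p k j) = inner_n r (eigvec r A k) (mv r B (eigvec r A k))"
      by (simp add: quadform_spectral[OF B] p_def)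
    finally show "exp (eigval r A k) *
      (1 + inner_n r (eigvec r A k) (mv r B (eigvec r A k)) - eigval r A k) =
      (\<Sum>j<r. p k j * (exp (eigval r A k) * (1 + eigval r B j - eigval r A k)))"
      using row k by (simp add: algebra_simps)
  qed simp
  also have "\<dots> \<le> (\<Sum>k<r. \<Sum>j<r. p k j * exp (eigval r B j))"
    by (intro sum_mono mult_left_mono exp_tangent) (simp add: p_def)
  also have "\<dots> = (\<Sum>j<r. (\<Sum>k<r. p k j) * exp (eigval r B j))"
    by (subst sum.swap) (simp add: sum_distrib_right)
  also have "\<dots> = trexp r B" by (simp add: col trexp_def)
  finally show ?thesis .
qed

lemma mv_rank_one_sum:
  assumes B: "\<And>i j. B i j = A i j + (\<Sum>s\<in>F. c s * (u s i * u s j))"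
  shows "inner_n r x (mv r B y) = inner_n r x (mv r A y) + (\<Sum>s\<in>F. c s * (inner_n r (u s) x * inner_n r (u s) y))"
proof -
  have "mv r B y = (\<lambda>i. mv r A y i + (\<Sum>s\<in>F. (c s * inner_n r (u s) y) * u s i))"
  proof
    fix i
    have "(\<Sum>j<r. (\<Sum>s\<in>F. c s * (u s i * u s j)) * y j) = (\<Sum>s\<in>F. \<Sum>j<r. c s * (u s i * u s j) * y j)"
      unfolding sum_distrib_right by (rule sum.swap)
    also have "\<dots> = (\<Sum>s\<in>F. (c s * inner_n r (u s) y) * u s i)"
      by (simp add: inner_n_def sum_distrib_left mult_ac)
    finally show "mv r B y i = mv r A y i + (\<Sum>s\<in>F. (c s * inner_n r (u s) y) * u s i)"
      by (simp add: mv_def B distrib_right sum.distrib)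
  qed
  then show ?thesis by (simp add: inner_n_add_right inner_n_sum_right inner_n_scale_right)
      (simp add: inner_n_commute mult_ac)
qed

text \<open>The coefficients may be negative, so this lower bound also provides upper bounds on
  \<open>trexp\<close>: let the perturbed matrix play the part of \<open>A\<close> and reverse the
  signs.\<close>

lemma klein_rank_one_sum:
  assumes A: "symm A" and B: "\<And>i j. B i j = A i j + (\<Sum>s\<in>F. c s * (u s i * u s j))"
  shows "trexp r A + (\<Sum>s\<in>F. c s * expform r A (u s)) \<le> trexp r B"
proof -
  have symB: "symm B" using A by (simp add: symm_def B mult_ac)
  have "trexp r A + (\<Sum>s\<in>F. c s * expform r A (u s))
      = (\<Sum>k<r. exp (eigval r A k) * (1 + (\<Sum>s\<in>F. c s * (inner_n r (u s) (eigvec r A k))\<^sup>2)))"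
  proof -
    have "(\<Sum>s\<in>F. c s * expform r A (u s))
        = (\<Sum>s\<in>F. \<Sum>k<r. exp (eigval r A k) * (c s * (inner_n r (u s) (eigvec r A k))\<^sup>2))"
      by (simp add: expform_def sum_distrib_left inner_n_commute mult_ac)
    also have "\<dots> = (\<Sum>k<r. exp (eigval r A k) * (\<Sum>s\<in>F. c s * (inner_n r (u s) (eigvec r A k))\<^sup>2))"
      by (subst sum.swap) (simp add: sum_distrib_left)
    finally show ?thesis by (simp add: trexp_def algebra_simps sum.distrib)
  qed
  also have "\<dots> = (\<Sum>k<r. exp (eigval r A k) *
      (1 + inner_n r (eigvec r A k) (mv r B (eigvec r A k)) - eigval r A k))"
    by (intro sum.cong refl)
      (simp add: mv_rank_one_sum[where B=B and A=A and F=F and c=c and u=u, OF B] inner_mv_eigvec[OF A] inner_eigvec_self[OF A] power2_eq_square)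
  also have "\<dots> \<le> trexp r B" by (rule klein[OF A symB])
  finally show ?thesis .
qed

text \<open>The trapezoid rule for a convex function: a divided difference of exp is at most the
  mean of its end values. Multiplying by (x - y)^2 covers x = y and supplies the factors that the
  comparison of two spectra consumes.\<close>

lemma exp_diff_mean_le:
  fixes x y :: real
  shows "(x - y) * (exp x - exp y) \<le> (x - y)\<^sup>2 * (exp x + exp y) / 2"
proof -
  have *: "(x - y) * (exp x - exp y) \<le> (x - y)\<^sup>2 * (exp x + exp y) / 2" if "y \<le> x" for x y :: real
  proof -
    define t where "t = x - y"
    have t: "t \<ge> 0" using that by (simp add: t_def)
    have "exp t - 1 \<le> t * (exp t + 1) / 2"
    proof -
      have "((\<lambda>t. t * (exp t + 1) / 2 - (exp t - 1)) has_real_derivative (t * exp t + 1 - exp t) / 2) (at t)" for t :: real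
        by (auto intro!: derivative_eq_intros simp: field_simps)
      moreover have "(t * exp t + 1 - exp t) / 2 \<ge> 0" for t :: real
      proof -
        have "exp t * (1 - t) \<le> exp t * exp (-t)"
          using exp_ge_add_one_self[of "-t"] by (intro mult_left_mono) auto
        then show ?thesis by (simp add: exp_add[symmetric] algebra_simps)
      qed
      ultimately have "(\<lambda>t. t * (exp t + 1) / 2 - (exp t - 1)) 0 \<le> (\<lambda>t. t * (exp t + 1) / 2 - (exp t - 1)) t"
        by (intro DERIV_nonneg_imp_nondecreasing[OF t]) (rule exI, rule conjI, assumption+)
      then show ?thesis by simp
    qed
    then have "exp y * t * (exp t - 1) \<le> exp y * t * (t * (exp t + 1) / 2)"
      using t by (intro mult_left_mono) auto
    moreover have "exp x = exp y * exp t" by (simp add: t_def exp_add[symmetric])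
    ultimately show ?thesis unfolding t_def[symmetric]
      by (simp add: algebra_simps power2_eq_square)
  qed
  show ?thesis
  proof (cases "y \<le> x")
    case False
    have "(x - y) * (exp x - exp y) = (y - x) * (exp y - exp x)" by (simp add: algebra_simps)
    also have "\<dots> \<le> (y - x)\<^sup>2 * (exp y + exp x) / 2" using False by (intro *) simp
    finally show ?thesis by (simp add: power2_commute add.commute)
  qed (rule *)
qed

text \<open>The scalar bound \<open>exp_diff_mean_le\<close> is applied to every pair of eigenvalues
  of \<open>B\<close> and \<open>A\<close>, weighted by the squared inner product of the
  eigenvectors. Each eigenvalue gap can be traded, together with one inner product, for a product of
  coordinates of v. One trade on the left leaves sums that Parseval contracts to
  \<open>expform\<close>; two trades on the right make the double sum factor.\<close>

lemma expform_rank_one_diff: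
  assumes A: "symm A" and c: "c > 0" and B: "\<And>i j. B i j = A i j + c * (v i * v j)"
  shows "expform r B v - expform r A v \<le> c * inner_n r v v / 2 * (expform r B v + expform r A v)"
proof -
  have symB: "symm B" using A by (simp add: symm_def B mult_ac)
  define q where "q = eigvec r A"
  define s where "s = eigvec r B"
  define l where "l = eigval r A"
  define \<mu> where "\<mu> = eigval r B"
  \<comment> \<open>Two evaluations of q_k^T B s_j: s_j is an eigenvector of B, and q_k is one of A
    = B - c v v^T.\<close>
  have rel: "(\<mu> j - l k) * inner_n r (q k) (s j) = c * (inner_n r (q k) v * inner_n r (s j) v)"
    if "k < r" "j < r" for k j
  proof -
    have "\<mu> j * inner_n r (q k) (s j) = inner_n r (q k) (mv r B (s j))"
      unfolding \<mu>_def s_def by (rule inner_mv_eigvec[OF symB that(2), symmetric])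
    also have "\<dots> = inner_n r (q k) (mv r A (s j)) + c * (inner_n r (q k) v * inner_n r (s j) v)"
      using mv_rank_one_sum[where B=B and A=A and F="{0::nat}" and c="\<lambda>_. c" and u="\<lambda>_. v" and r=r and x="q k" and y="s j"]
      by (simp add: B inner_n_commute)
    also have "inner_n r (q k) (mv r A (s j)) = inner_n r (s j) (mv r A (q k))"
      using A by (intro mv_symmetric) (simp add: symm_def)
    also have "\<dots> = l k * inner_n r (q k) (s j)"
      unfolding l_def q_def inner_mv_eigvec[OF A that(1)] by (simp add: inner_n_commute)
    finally show ?thesis by (simp add: algebra_simps)
  qed
  have pq: "(\<Sum>k<r. inner_n r (q k) v * inner_n r (q k) y) = inner_n r v y" for y
    unfolding q_def by (rule parseval[OF eigvec_orthonormal[OF A]])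
  have ps: "(\<Sum>j<r. inner_n r (s j) v * inner_n r (s j) y) = inner_n r v y" for y
    unfolding s_def by (rule parseval[OF eigvec_orthonormal[OF symB]])
  let ?P = "\<lambda>k j. inner_n r (q k) v * inner_n r (s j) v"
  have L: "(\<Sum>k<r. \<Sum>j<r. (inner_n r (q k) (s j))\<^sup>2 * ((\<mu> j - l k) * (exp (\<mu> j) - exp (l k))))
      = c * (expform r B v - expform r A v)"
  proof -
    have "(inner_n r (q k) (s j))\<^sup>2 * ((\<mu> j - l k) * (exp (\<mu> j) - exp (l k)))
       = c * (?P k j * inner_n r (q k) (s j) * exp (\<mu> j)) - c * (?P k j * inner_n r (q k) (s j) * exp (l k))"
      if "k < r" "j < r" for k j
    proof -
      have "(inner_n r (q k) (s j))\<^sup>2 * ((\<mu> j - l k) * (exp (\<mu> j) - exp (l k)))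
        = ((\<mu> j - l k) * inner_n r (q k) (s j)) * inner_n r (q k) (s j) * (exp (\<mu> j) - exp (l k))"
        by (simp add: power2_eq_square)
      then show ?thesis unfolding rel[OF that] by (simp add: algebra_simps)
    qed
    then have "(\<Sum>k<r. \<Sum>j<r. (inner_n r (q k) (s j))\<^sup>2 * ((\<mu> j - l k) * (exp (\<mu> j) - exp (l k))))
       = c * (\<Sum>k<r. \<Sum>j<r. ?P k j * inner_n r (q k) (s j) * exp (\<mu> j))
         - c * (\<Sum>k<r. \<Sum>j<r. ?P k j * inner_n r (q k) (s j) * exp (l k))"
      by (simp add: sum_subtractf sum_distrib_left)
    also have "(\<Sum>k<r. \<Sum>j<r. ?P k j * inner_n r (q k) (s j) * exp (\<mu> j)) = expform r B v"
    proof -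
      have "(\<Sum>k<r. \<Sum>j<r. ?P k j * inner_n r (q k) (s j) * exp (\<mu> j))
        = (\<Sum>j<r. (\<Sum>k<r. inner_n r (q k) v * inner_n r (q k) (s j)) * inner_n r (s j) v * exp (\<mu> j))"
        unfolding sum_distrib_right by (subst sum.swap) (simp add: mult_ac)
      then show ?thesis unfolding pq
        by (simp add: expform_def s_def \<mu>_def inner_n_commute power2_eq_square mult_ac)
    qed
    also have "(\<Sum>k<r. \<Sum>j<r. ?P k j * inner_n r (q k) (s j) * exp (l k)) = expform r A v"
    proof -
      have "(\<Sum>k<r. \<Sum>j<r. ?P k j * inner_n r (q k) (s j) * exp (l k))
        = (\<Sum>k<r. (\<Sum>j<r. inner_n r (s j) v * inner_n r (s j) (q k)) * inner_n r (q k) v * exp (l k))"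
        unfolding sum_distrib_right by (simp add: mult_ac inner_n_commute)
      then show ?thesis unfolding ps
        by (simp add: expform_def q_def l_def inner_n_commute power2_eq_square mult_ac)
    qed
    finally show ?thesis by (simp add: algebra_simps)
  qed
  have R: "(\<Sum>k<r. \<Sum>j<r. (inner_n r (q k) (s j))\<^sup>2 * ((\<mu> j - l k)\<^sup>2 * (exp (\<mu> j) + exp (l k)) / 2))
      = c\<^sup>2 / 2 * inner_n r v v * (expform r B v + expform r A v)"
  proof -
    let ?a = "\<lambda>k. (inner_n r (q k) v)\<^sup>2" and ?b = "\<lambda>j. (inner_n r (s j) v)\<^sup>2"
    have "(inner_n r (q k) (s j))\<^sup>2 * ((\<mu> j - l k)\<^sup>2 * (exp (\<mu> j) + exp (l k)) / 2)
       = c\<^sup>2 / 2 * (?a k * (?b j * exp (\<mu> j))) + c\<^sup>2 / 2 * (?b j * (?a k * exp (l k)))"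
      if "k < r" "j < r" for k j
    proof -
      have "(inner_n r (q k) (s j))\<^sup>2 * ((\<mu> j - l k)\<^sup>2 * (exp (\<mu> j) + exp (l k)) / 2)
        = ((\<mu> j - l k) * inner_n r (q k) (s j))\<^sup>2 * (exp (\<mu> j) + exp (l k)) / 2"
        by (simp add: power_mult_distrib)
      then show ?thesis unfolding rel[OF that] by (simp add: power2_eq_square algebra_simps)
    qed
    then have "(\<Sum>k<r. \<Sum>j<r. (inner_n r (q k) (s j))\<^sup>2 * ((\<mu> j - l k)\<^sup>2 * (exp (\<mu> j) + exp (l k)) / 2))
      = c\<^sup>2 / 2 * (\<Sum>k<r. \<Sum>j<r. ?a k * (?b j * exp (\<mu> j))) + c\<^sup>2 / 2 * (\<Sum>k<r. \<Sum>j<r. ?b j * (?a k * exp (l k)))"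
      by (simp add: sum.distrib sum_distrib_left add_divide_distrib)
    also have "(\<Sum>k<r. \<Sum>j<r. ?a k * (?b j * exp (\<mu> j))) = inner_n r v v * expform r B v"
    proof -
      have "(\<Sum>k<r. \<Sum>j<r. ?a k * (?b j * exp (\<mu> j))) = (\<Sum>k<r. ?a k) * (\<Sum>j<r. ?b j * exp (\<mu> j))"
        by (rule sum_product[symmetric])
      also have "(\<Sum>k<r. ?a k) = inner_n r v v"
        unfolding q_def by (rule parseval_eigvec[OF A])
      also have "(\<Sum>j<r. ?b j * exp (\<mu> j)) = expform r B v"
        by (simp add: expform_def s_def \<mu>_def mult.commute)
      finally show ?thesis .
    qed
    also have "(\<Sum>k<r. \<Sum>j<r. ?b j * (?a k * exp (l k))) = inner_n r v v * expform r A v"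
    proof -
      have "(\<Sum>k<r. \<Sum>j<r. ?b j * (?a k * exp (l k))) = (\<Sum>j<r. \<Sum>k<r. ?b j * (?a k * exp (l k)))"
        by (rule sum.swap)
      also have "\<dots> = (\<Sum>j<r. ?b j) * (\<Sum>k<r. ?a k * exp (l k))"
        by (rule sum_product[symmetric])
      also have "(\<Sum>j<r. ?b j) = inner_n r v v"
        unfolding s_def by (rule parseval_eigvec[OF symB])
      also have "(\<Sum>k<r. ?a k * exp (l k)) = expform r A v"
        by (simp add: expform_def q_def l_def mult.commute)
      finally show ?thesis .
    qed
    finally show ?thesis by (simp add: algebra_simps)
  qed
  have "c * (expform r B v - expform r A v) \<le> c\<^sup>2 / 2 * inner_n r v v * (expform r B v + expform r A v)"
    unfolding L[symmetric] R[symmetric]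
    by (intro sum_mono mult_left_mono exp_diff_mean_le) simp
  also have "\<dots> = c * (c * inner_n r v v / 2 * (expform r B v + expform r A v))"
    by (simp add: power2_eq_square)
  finally show ?thesis using c by simp
qed

text \<open>The hypothesis rearranges to y (1 - a) <= x (1 + a), and (1 + a) / (1 - a) <= 1 + 4 a
  for a up to 1/2.\<close>

lemma growth_factor_le:
  fixes a :: real
  assumes "0 \<le> a" "a \<le> 1/2" "y - x \<le> a * (y + x)" "0 \<le> x"
  shows "y \<le> exp (4 * a) * x"
proof -
  have e: "1 + 4 * a \<le> exp (4 * a)" by (rule exp_ge_add_one_self)
  have "y * (1 - a) \<le> x * (1 + a)" using assms(3) by (simp add: algebra_simps)
  also have "x * (1 + a) \<le> x * ((1 + 4 * a) * (1 - a))"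
  proof (rule mult_left_mono)
    have "a * a \<le> a * (1/2)" using assms by (intro mult_left_mono) auto
    then show "1 + a \<le> (1 + 4 * a) * (1 - a)" by (simp add: algebra_simps)
  qed (fact assms)
  also have "\<dots> = ((1 + 4 * a) * x) * (1 - a)" by simp
  finally have "y \<le> (1 + 4 * a) * x" using assms by (simp add: mult_le_cancel_right)
  also have "\<dots> \<le> exp (4 * a) * x" using assms e by (intro mult_right_mono) auto
  finally show ?thesis .
qed

text \<open>The estimate \<open>expform_rank_one_diff\<close> is informative only while c |v|^2 < 2,
  so the perturbation is added in N equal parts, with N > c |v|^2 to meet the condition a <= 1/2 of
  \<open>growth_factor_le\<close>. The N factors multiply to a bound that is independent of
  N.\<close>

lemma expform_rank_one_le:
  assumes A: "symm A" and c: "c \<ge> 0" and B: "\<And>i j. B i j = A i j + c * (v i * v j)"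
  shows "expform r B v \<le> exp (2 * c * inner_n r v v) * expform r A v"
proof (cases "c = 0")
  case True
  then have "B = A" using B by (simp add: fun_eq_iff)
  then show ?thesis using True by simp
next
  case False
  then have c: "c > 0" using c by simp
  define T where "T = inner_n r v v"
  have T: "T \<ge> 0" by (simp add: T_def inner_n_nonneg)
  obtain N :: nat where N: "c * T < real N" using reals_Archimedean2 by blast
  then have N0: "real N > 0" using mult_nonneg_nonneg[of c T] c T by linarith
  define Z where "Z k = (\<lambda>i j. A i j + real k * (c / N) * (v i * v j))" for k :: nat
  have symZ: "symm (Z k)" for k using A by (simp add: symm_def Z_def mult_ac)
  have step: "expform r (Z (Suc k)) v \<le> exp (2 * (c / N) * T) * expform r (Z k) v" for k
  proof -
    have "expform r (Z (Suc k)) v - expform r (Z k) v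
        \<le> c / N * inner_n r v v / 2 * (expform r (Z (Suc k)) v + expform r (Z k) v)"
      by (rule expform_rank_one_diff[OF symZ]) (use c N0 in \<open>auto simp: Z_def algebra_simps add_divide_distrib\<close>)
    then have "expform r (Z (Suc k)) v \<le> exp (4 * (c / N * T / 2)) * expform r (Z k) v"
      using c T N N0 expform_nonneg
      by (intro growth_factor_le) (auto simp: T_def[symmetric] field_simps)
    then show ?thesis by (simp add: mult_ac)
  qed
  have "expform r (Z k) v \<le> exp (real k * (2 * (c / N) * T)) * expform r A v" for k
  proof (induction k)
    case 0
    have "Z 0 = A" by (simp add: Z_def)
    then show ?case by simp
  next
    case (Suc k)
    have "expform r (Z (Suc k)) v \<le> exp (2 * (c / N) * T) * expform r (Z k) v" by (rule step)
    also have "\<dots> \<le> exp (2 * (c / N) * T) * (exp (real k * (2 * (c / N) * T)) * expform r A v)"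
      using Suc by (intro mult_left_mono) auto
    also have "\<dots> = exp (real (Suc k) * (2 * (c / N) * T)) * expform r A v"
      by (simp add: exp_add[symmetric] distrib_right add_divide_distrib del: exp_le_cancel_iff)
    finally show ?case .
  qed
  from this[of N] have "expform r (Z N) v \<le> exp (2 * c * T) * expform r A v"
    using N0 by (simp add: mult_ac)
  moreover have "Z N = B" using N0 by (simp add: Z_def B fun_eq_iff)
  ultimately show ?thesis by (simp add: T_def)
qed

text \<open>Jensen's inequality, with the squared coordinates of x in the eigenbasis as probability
  weights, each at most 1. A single trace dominates all unit x at once, so no net of directions is
  taken; the price is the initial value r of the trace.\<close>

lemma exp_quadform_le_trexp:
  assumes A: "symm A" and x: "inner_n r x x = 1"
  shows "exp (inner_n r x (mv r A x)) \<le> trexp r A"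
proof -
  let ?p = "\<lambda>k. (inner_n r (eigvec r A k) x)\<^sup>2"
  define m where "m = inner_n r x (mv r A x)"
  have p1: "(\<Sum>k<r. ?p k) = 1" using parseval_eigvec[OF A] x by simp
  have pm: "(\<Sum>k<r. eigval r A k * ?p k) = m" by (simp add: m_def quadform_spectral[OF A])
  have "exp m = exp m * ((\<Sum>k<r. ?p k) * (1 - m) + (\<Sum>k<r. eigval r A k * ?p k))"
    unfolding p1 pm by simp
  also have "\<dots> = (\<Sum>k<r. ?p k * (exp m * (1 + eigval r A k - m)))"
    by (simp add: sum_distrib_left sum_distrib_right sum.distrib[symmetric] algebra_simps)
  also have "\<dots> \<le> (\<Sum>k<r. ?p k * exp (eigval r A k))"
    by (intro sum_mono mult_left_mono exp_tangent) simp
  also have "\<dots> \<le> (\<Sum>k<r. 1 * exp (eigval r A k))"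
  proof (intro sum_mono mult_right_mono)
    fix k assume "k \<in> {..<r}"
    then have "?p k \<le> (\<Sum>k<r. ?p k)" by (intro member_le_sum) auto
    then show "?p k \<le> 1" using p1 by simp
  qed simp
  finally show ?thesis by (simp add: m_def trexp_def)
qed

lemma trexp_zero: "trexp r (\<lambda>i j. 0) = real r"
proof -
  have s: "symm (\<lambda>i j. 0)" by (simp add: symm_def)
  have "eigval r (\<lambda>i j. 0) k = 0" if "k < r" for k
    using inner_mv_eigvec[OF s that, of "eigvec r (\<lambda>i j. 0) k"] inner_eigvec_self[OF s that]
    by (simp add: mv_def inner_n_def)
  then show ?thesis by (simp add: trexp_def)
qed

subsection \<open>Rademacher averages\<close>

definition signs :: "nat set \<Rightarrow> (nat \<Rightarrow> real) set" where
  "signs K = PiE K (\<lambda>_. {-1, 1})"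

definition savg :: "nat set \<Rightarrow> ((nat \<Rightarrow> real) \<Rightarrow> real) \<Rightarrow> real" where
  "savg K f = (\<Sum>\<tau>\<in>signs K. f \<tau>) / 2 ^ card K"

definition comb :: "nat set \<Rightarrow> (nat \<Rightarrow> nat \<Rightarrow> real) \<Rightarrow> (nat \<Rightarrow> real) \<Rightarrow> nat \<Rightarrow> real" where
  "comb K u \<tau> = (\<lambda>a. \<Sum>i\<in>K. \<tau> i * u i a)"

lemma finite_signs: "finite K \<Longrightarrow> finite (signs K)"
  by (simp add: signs_def finite_PiE)

lemma card_signs: "finite K \<Longrightarrow> card (signs K) = 2 ^ card K"
  by (simp add: signs_def card_PiE card_insert_if numeral_2_eq_2)

lemma savg_const: "finite K \<Longrightarrow> savg K (\<lambda>_. c) = c"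
  by (simp add: savg_def card_signs)

lemma savg_add: "savg K (\<lambda>\<tau>. f \<tau> + g \<tau>) = savg K f + savg K g"
  by (simp add: savg_def sum.distrib add_divide_distrib)

lemma savg_diff: "savg K (\<lambda>\<tau>. f \<tau> - g \<tau>) = savg K f - savg K g"
  by (simp add: savg_def sum_subtractf diff_divide_distrib)

lemma savg_scale: "savg K (\<lambda>\<tau>. c * f \<tau>) = c * savg K f"
  by (simp add: savg_def sum_distrib_left)

lemma savg_sum: "savg K (\<lambda>\<tau>. \<Sum>i\<in>F. f i \<tau>) = (\<Sum>i\<in>F. savg K (f i))"
  unfolding savg_def sum_divide_distrib by (rule sum.swap)

lemma savg_mono: "(\<And>\<tau>. \<tau> \<in> signs K \<Longrightarrow> f \<tau> \<le> g \<tau>) \<Longrightarrow> savg K f \<le> savg K g"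
  unfolding savg_def by (intro divide_right_mono sum_mono) auto

lemma savg_cong: "(\<And>\<tau>. \<tau> \<in> signs K \<Longrightarrow> f \<tau> = g \<tau>) \<Longrightarrow> savg K f = savg K g"
  unfolding savg_def by (simp cong: sum.cong)

lemma savg_empty: "savg {} f = f (\<lambda>_. undefined)"
  by (simp add: savg_def signs_def)

lemma savg_insert:
  assumes K: "finite K" "j \<notin> K"
  shows "savg (insert j K) f = savg K (\<lambda>\<tau>. (f (\<tau>(j := 1)) + f (\<tau>(j := -1))) / 2)"
proof -
  have inj: "inj_on (\<lambda>(y, g). g(j := y)) ({-1, 1::real} \<times> signs K)"
    unfolding signs_def using inj_combinator[OF K(2), of "\<lambda>_. {-1, 1::real}"] by simp
  have "(\<Sum>\<tau>\<in>signs (insert j K). f \<tau>) = (\<Sum>(y, g)\<in>{-1, 1} \<times> signs K. f (g(j := y)))"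
    unfolding signs_def PiE_insert_eq
    by (subst sum.reindex[OF inj[unfolded signs_def]]) (simp add: case_prod_unfold)
  also have "\<dots> = (\<Sum>y\<in>{-1, 1}. \<Sum>g\<in>signs K. f (g(j := y)))"
    by (simp add: sum.cartesian_product)
  also have "\<dots> = (\<Sum>g\<in>signs K. f (g(j := -1))) + (\<Sum>g\<in>signs K. f (g(j := 1)))"
    by simp
  finally show ?thesis
    using K by (simp add: savg_def sum.distrib sum_divide_distrib[symmetric] add_divide_distrib)
qed

lemma comb_insert:
  assumes "finite K" "j \<notin> K"
  shows "comb (insert j K) u (\<tau>(j := s)) = (\<lambda>a. comb K u \<tau> a + s * u j a)"
proof -
  have "(\<Sum>i\<in>K. (\<tau>(j := s)) i * u i a) = (\<Sum>i\<in>K. \<tau> i * u i a)" for a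
    by (intro sum.cong) (use assms in auto)
  then show ?thesis using assms by (simp add: comb_def fun_eq_iff)
qed

text \<open>Hoeffding's bound for one sign, cosh x <= exp(x^2/2). Multiplied by 2 exp(-x), it says
  that \<open>?f\<close>, which vanishes at 0, is nonnegative. The sign of its derivative reduces to
  the monotonicity of \<open>?g\<close>, whose derivative is visibly nonnegative.\<close>

lemma exp_plus_exp_minus_le: "(exp x + exp (-x)) / 2 \<le> exp (x\<^sup>2 / 2 :: real)"
proof -
  have *: "(exp x + exp (-x)) / 2 \<le> exp (x\<^sup>2 / 2)" if "0 \<le> x" for x :: real
  proof -
    let ?f = "\<lambda>x::real. exp (x\<^sup>2 / 2 - x) * 2 - 1 - exp (- 2 * x)"
    have "?f 0 \<le> ?f x"
    proof (rule DERIV_nonneg_imp_nondecreasing[OF that], intro exI conjI)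
      fix t :: real assume t: "0 \<le> t"
      show "(?f has_real_derivative (2 * (t - 1) * exp (t\<^sup>2 / 2 - t) + 2 * exp (- 2 * t))) (at t)"
        by (auto intro!: derivative_eq_intros)
      have "(1 - t) * exp (t\<^sup>2 / 2 + t) \<le> 1"
      proof -
        let ?g = "\<lambda>t::real. - ((1 - t) * exp (t\<^sup>2 / 2 + t))"
        have "?g 0 \<le> ?g t"
        proof (rule DERIV_nonneg_imp_nondecreasing[OF t], intro exI conjI)
          fix s :: real assume s: "0 \<le> s"
          show "(?g has_real_derivative (s\<^sup>2 * exp (s\<^sup>2 / 2 + s))) (at s)"
            by (auto intro!: derivative_eq_intros simp: algebra_simps power2_eq_square)
          show "0 \<le> s\<^sup>2 * exp (s\<^sup>2 / 2 + s)" by simp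
        qed
        then show ?thesis by simp
      qed
      then have "(1 - t) * exp (t\<^sup>2 / 2 + t) * exp (- 2 * t) \<le> 1 * exp (- 2 * t)"
        by (intro mult_right_mono) auto
      also have "(1 - t) * exp (t\<^sup>2 / 2 + t) * exp (- 2 * t) = (1 - t) * exp (t\<^sup>2 / 2 - t)"
        by (simp add: mult.assoc exp_add[symmetric])
      finally show "0 \<le> 2 * (t - 1) * exp (t\<^sup>2 / 2 - t) + 2 * exp (- 2 * t)"
        by (simp add: algebra_simps)
    qed
    then have "(1 + exp (- 2 * x)) * exp x \<le> exp (x\<^sup>2 / 2 - x) * 2 * exp x"
      by (intro mult_right_mono) auto
    moreover have "exp (- 2 * x) * exp x = exp (-x)" "exp (x\<^sup>2 / 2 - x) * exp x = exp (x\<^sup>2 / 2)"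
      by (simp_all add: exp_add[symmetric])
    ultimately show ?thesis by (simp add: algebra_simps)
  qed
  show ?thesis using *[of x] *[of "-x"] by (cases "0 \<le> x") (auto simp: add.commute)
qed

text \<open>Adding a random sign times u turns the exponent at most from a into a + 2 a^2 |u|^2, so the
  exponent stays bounded as long as a times the total squared length is small.\<close>

lemma savg_exp_sqnorm:
  assumes "finite K" "0 \<le> a" "4 * a * (\<Sum>i\<in>K. inner_n r (u i) (u i)) \<le> 1"
  shows "savg K (\<lambda>\<tau>. exp (a * inner_n r (comb K u \<tau>) (comb K u \<tau>)))
    \<le> exp (2 * a * (\<Sum>i\<in>K. inner_n r (u i) (u i)))"
  using assms
proof (induction K arbitrary: a rule: finite_induct)
  case empty
  show ?case by (simp add: savg_empty comb_def inner_n_def)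
next
  case (insert j K)
  define s where "s = inner_n r (u j) (u j)"
  define S where "S = (\<Sum>i\<in>K. inner_n r (u i) (u i))"
  have s: "0 \<le> s" "0 \<le> S" by (auto simp: s_def S_def inner_n_nonneg intro: sum_nonneg)
  have tot: "(\<Sum>i\<in>insert j K. inner_n r (u i) (u i)) = s + S"
    using insert.hyps by (simp add: s_def S_def)
  have le1: "4 * a * (s + S) \<le> 1" using insert.prems tot by simp
  define b where "b = a + 2 * a\<^sup>2 * s"
  have as: "0 \<le> a * s" "0 \<le> a * S" using s insert.prems by auto
  have aS: "4 * a * S \<le> 1" using le1 as by (simp add: algebra_simps)
  have b0: "0 \<le> b" using s insert.prems by (simp add: b_def)
  \<comment> \<open>The growth from a to b is paid by removing \<open>u j\<close> from the budget: 4
    b S exceeds 4 a S by 8 a^2 s S <= 2 a s, while the hypothesis leaves room for 4 a s.\<close>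
  have quad: "4 * (a * S) * (a * s) \<le> 1 * (a * s)"
    using aS as by (intro mult_right_mono) auto
  then have quad': "4 * a\<^sup>2 * s * S \<le> a * s" by (simp add: power2_eq_square algebra_simps)
  have b1: "4 * b * S \<le> 1"
    using quad' le1 as by (simp add: b_def algebra_simps)
  have b2: "a * s + 2 * b * S \<le> 2 * a * (s + S)"
    using quad' as by (simp add: b_def algebra_simps)
  have pt: "(exp (a * inner_n r (comb (insert j K) u (\<tau>(j := 1))) (comb (insert j K) u (\<tau>(j := 1))))
      + exp (a * inner_n r (comb (insert j K) u (\<tau>(j := -1))) (comb (insert j K) u (\<tau>(j := -1))))) / 2
      \<le> exp (a * s) * exp (b * inner_n r (comb K u \<tau>) (comb K u \<tau>))" for \<tau>
  proof -
    define v where "v = comb K u \<tau>"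
    define V where "V = inner_n r v v"
    \<comment> \<open>The new sign affects only this cross term. Averaging over it costs D^2/2,
      which by Cauchy-Schwarz is at most 2 a^2 s V; this is the origin of b.\<close>
    define D where "D = 2 * a * inner_n r v (u j)"
    have e: "a * inner_n r (comb (insert j K) u (\<tau>(j := t))) (comb (insert j K) u (\<tau>(j := t)))
        = a * (V + t\<^sup>2 * s) + t * D" for t
      unfolding comb_insert[OF insert.hyps(1,2)] v_def[symmetric] inner_n_add_left inner_n_add_right
        inner_n_scale_left inner_n_scale_right inner_n_commute[of r "u j" v]
      by (simp add: V_def D_def s_def power2_eq_square algebra_simps)
    have "D\<^sup>2 / 2 \<le> 2 * a\<^sup>2 * (V * s)"
      using inner_n_Cauchy_Schwarz[of r v "u j"]
      by (simp add: D_def V_def s_def power_mult_distrib mult_left_mono)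
    then have "a * (V + s) + D\<^sup>2 / 2 \<le> a * s + b * V"
      by (simp add: b_def algebra_simps)
    have "(exp (a * (V + s) + D) + exp (a * (V + s) - D)) / 2 = exp (a * (V + s)) * ((exp D + exp (-D)) / 2)"
      by (simp add: exp_add exp_diff exp_minus field_simps)
    also have "\<dots> \<le> exp (a * (V + s)) * exp (D\<^sup>2 / 2)"
      by (intro mult_left_mono exp_plus_exp_minus_le) simp
    also have "\<dots> = exp (a * (V + s) + D\<^sup>2 / 2)" by (simp add: exp_add)
    also have "\<dots> \<le> exp (a * s + b * V)" using \<open>a * (V + s) + D\<^sup>2 / 2 \<le> a * s + b * V\<close> by simp
    finally show ?thesis unfolding e v_def[symmetric] V_def[symmetric] by (simp add: exp_add)
  qed
  have "savg (insert j K) (\<lambda>\<tau>. exp (a * inner_n r (comb (insert j K) u \<tau>) (comb (insert j K) u \<tau>)))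
      \<le> savg K (\<lambda>\<tau>. exp (a * s) * exp (b * inner_n r (comb K u \<tau>) (comb K u \<tau>)))"
    unfolding savg_insert[OF insert.hyps(1,2)] by (rule savg_mono) (rule pt)
  also have "\<dots> \<le> exp (a * s) * exp (2 * b * S)"
    unfolding savg_scale S_def
    by (intro mult_left_mono insert.IH) (use b0 b1 S_def in auto)
  also have "\<dots> \<le> exp (2 * a * (s + S))"
    using b2 by (simp add: exp_add[symmetric])
  finally show ?case unfolding tot .
qed

lemma savg_second_moment:
  assumes "finite K"
  shows "savg K (\<lambda>\<tau>. (inner_n r (comb K u \<tau>) x)\<^sup>2) = (\<Sum>i\<in>K. (inner_n r (u i) x)\<^sup>2)"
  using assms
proof (induction K rule: finite_induct)
  case empty
  show ?case by (simp add: savg_empty comb_def inner_n_def)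
next
  case (insert j K)
  have "savg (insert j K) (\<lambda>\<tau>. (inner_n r (comb (insert j K) u \<tau>) x)\<^sup>2)
      = savg K (\<lambda>\<tau>. (inner_n r (comb K u \<tau>) x)\<^sup>2 + (inner_n r (u j) x)\<^sup>2)"
    unfolding savg_insert[OF insert.hyps(1,2)] comb_insert[OF insert.hyps(1,2)] inner_n_add_left inner_n_scale_left
    by (rule savg_cong) (simp add: power2_eq_square field_simps)
  then show ?case using insert by (simp add: savg_add savg_const)
qed

lemma inner_n_comb_left: "inner_n r (comb K u \<tau>) x = (\<Sum>i\<in>K. \<tau> i * inner_n r (u i) x)"
  by (simp add: comb_def inner_n_sum_left inner_n_scale_left)

section \<open>Second moments under an exponential weight\<close>

lemma sq_le_exp:
  assumes "0 \<le> (y::real)"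
  shows "y\<^sup>2 \<le> 2 * exp y"
  using exp_lower_Taylor_quadratic[OF assms] assms by simp

text \<open>With |v|^2 normalised by w and <v, x>^2 by X, the AM-GM inequality splits the product
  into two squares, each controlled by an exponential moment at rate 1/4. Normalising by X makes the
  bound proportional to the quadratic form of sum u_i u_i^T at x, which is what compensation by a
  multiple of that matrix requires. The constant is 320 = 128 * 2 + 32 * 2.\<close>

lemma savg_cross_moment:
  assumes K: "finite K" and w: "0 < w" "(\<Sum>i\<in>K. inner_n r (u i) (u i)) \<le> w"
    and t: "0 \<le> \<theta>" "\<theta> * w \<le> 1 / 32"
  shows "savg K (\<lambda>\<tau>. 2 * \<theta> * inner_n r (comb K u \<tau>) (comb K u \<tau>)
      * exp (2 * \<theta> * inner_n r (comb K u \<tau>) (comb K u \<tau>)) * (inner_n r (comb K u \<tau>) x)\<^sup>2)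
    \<le> 320 * \<theta> * w * (\<Sum>i\<in>K. (inner_n r (u i) x)\<^sup>2)"
proof -
  define X where "X = (\<Sum>i\<in>K. (inner_n r (u i) x)\<^sup>2)"
  define N where "N \<tau> = inner_n r (comb K u \<tau>) (comb K u \<tau>) / w" for \<tau>
  define Y where "Y \<tau> = (inner_n r (comb K u \<tau>) x)\<^sup>2" for \<tau>
  have N: "inner_n r (comb K u \<tau>) (comb K u \<tau>) = w * N \<tau>" "0 \<le> N \<tau>" for \<tau>
    using w by (auto simp: N_def inner_n_nonneg)
  have X0: "0 \<le> X" by (simp add: X_def sum_nonneg)
  show ?thesis
  proof (cases "X = 0")
    case True
    then have "inner_n r (u i) x = 0" if "i \<in> K" for i
      using that K unfolding X_def by (subst (asm) sum_nonneg_eq_0_iff) auto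
    then have "inner_n r (comb K u \<tau>) x = 0" for \<tau>
      by (simp add: inner_n_comb_left)
    then show ?thesis using True by (simp add: X_def[symmetric] savg_const K)
  next
    case False
    then have X: "0 < X" using X0 by simp
    have pt: "2 * \<theta> * inner_n r (comb K u \<tau>) (comb K u \<tau>)
        * exp (2 * \<theta> * inner_n r (comb K u \<tau>) (comb K u \<tau>)) * (inner_n r (comb K u \<tau>) x)\<^sup>2
      \<le> \<theta> * w * X * (128 * exp (N \<tau> / 4) + 32 * exp (Y \<tau> / (4 * X)))" for \<tau>
    proof -
      define n where "n = N \<tau>"
      define y where "y = Y \<tau> / X"
      define e where "e = exp (2 * \<theta> * (w * n))"
      have n: "0 \<le> n" by (simp add: n_def N)
      have y: "0 \<le> y" using X by (simp add: y_def Y_def)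
      have "2 * (n * e) * y \<le> (n * e)\<^sup>2 + y\<^sup>2"
        using sum_squares_bound[of "n * e" y] by simp
      also have "(n * e)\<^sup>2 \<le> 128 * exp (n / 4)"
      proof -
        \<comment> \<open>This is where \<theta> w <= 1/32 enters. The square uses rate 1/8 and n^2
          another 1/8, together the rate 1/4 that \<open>savg_exp_sqnorm\<close> can still
          integrate.\<close>
        have "e \<le> exp (n / 16)"
          using mult_right_mono[OF t(2) n] by (simp add: e_def algebra_simps)
        then have "e\<^sup>2 \<le> (exp (n / 16))\<^sup>2" by (intro power_mono) (auto simp: e_def)
        also have "\<dots> = exp (n / 8)" by (simp add: exp_double[symmetric])
        finally have e2: "e\<^sup>2 \<le> exp (n / 8)" .
        have "(n / 8)\<^sup>2 \<le> 2 * exp (n / 8)" using n by (intro sq_le_exp) simp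
        then have n2: "n\<^sup>2 \<le> 128 * exp (n / 8)" by (simp add: power_divide)
        have "n\<^sup>2 * e\<^sup>2 \<le> 128 * exp (n / 8) * exp (n / 8)"
          using n2 e2 by (intro mult_mono) auto
        also have "\<dots> = 128 * exp (n / 4)" by (simp add: mult.assoc exp_add[symmetric])
        finally show ?thesis by (simp add: power_mult_distrib)
      qed
      also have "y\<^sup>2 \<le> 32 * exp (y / 4)"
        using sq_le_exp[of "y / 4"] y by (simp add: power_divide)
      finally have "2 * (n * e) * y \<le> 128 * exp (n / 4) + 32 * exp (y / 4)" by simp
      then have "\<theta> * w * X * (2 * (n * e) * y) \<le> \<theta> * w * X * (128 * exp (n / 4) + 32 * exp (y / 4))"
        using t w X by (intro mult_left_mono) auto
      moreover have "X * y = (inner_n r (comb K u \<tau>) x)\<^sup>2" using X by (simp add: y_def Y_def)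
      then have "\<theta> * w * X * (2 * (n * e) * y) = 2 * \<theta> * (w * n) * e * (inner_n r (comb K u \<tau>) x)\<^sup>2"
        by (metis (no_types, lifting) mult.commute mult.left_commute)
      moreover have "y / 4 = Y \<tau> / (4 * X)" by (simp add: y_def)
      ultimately show ?thesis unfolding N(1) n_def e_def by (simp only: mult.assoc)
    qed
    have m1: "savg K (\<lambda>\<tau>. exp (N \<tau> / 4)) \<le> 2"
    proof -
      have "savg K (\<lambda>\<tau>. exp (N \<tau> / 4)) = savg K (\<lambda>\<tau>. exp (1 / (4 * w) * inner_n r (comb K u \<tau>) (comb K u \<tau>)))"
        by (simp add: N_def mult.commute)
      also have "\<dots> \<le> exp (2 * (1 / (4 * w)) * (\<Sum>i\<in>K. inner_n r (u i) (u i)))"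
        using K w by (intro savg_exp_sqnorm) auto
      also have "\<dots> \<le> exp (1 / 2)" using w by simp
      finally show ?thesis using exp_half_le2 by simp
    qed
    have m2: "savg K (\<lambda>\<tau>. exp (Y \<tau> / (4 * X))) \<le> 2"
    proof -
      \<comment> \<open>The scalar <v, x> is a signed sum of the numbers <u_i, x>; as vectors of
        dimension 1 they fall under the same exponential bound.\<close>
      define u1 where "u1 i = (\<lambda>_::nat. inner_n r (u i) x)" for i
      have Y1: "inner_n 1 (comb K u1 \<tau>) (comb K u1 \<tau>) = Y \<tau>" for \<tau>
        proof -
        have "comb K u1 \<tau> 0 = inner_n r (comb K u \<tau>) x"
          unfolding inner_n_comb_left by (simp add: comb_def u1_def)
        then show ?thesis by (simp add: Y_def inner_n_def[of "Suc 0"] power2_eq_square)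
      qed
      have X1: "(\<Sum>i\<in>K. inner_n 1 (u1 i) (u1 i)) = X"
        by (simp add: inner_n_def u1_def power2_eq_square X_def)
      have "savg K (\<lambda>\<tau>. exp (1 / (4 * X) * inner_n 1 (comb K u1 \<tau>) (comb K u1 \<tau>)))
        \<le> exp (2 * (1 / (4 * X)) * (\<Sum>i\<in>K. inner_n 1 (u1 i) (u1 i)))"
        using K X by (intro savg_exp_sqnorm) (auto simp: X1[simplified])
      also have "\<dots> = exp (1 / 2)" unfolding X1 using X by simp
      finally show ?thesis using exp_half_le2 unfolding Y1 by simp
    qed
    have "savg K (\<lambda>\<tau>. 2 * \<theta> * inner_n r (comb K u \<tau>) (comb K u \<tau>)
        * exp (2 * \<theta> * inner_n r (comb K u \<tau>) (comb K u \<tau>)) * (inner_n r (comb K u \<tau>) x)\<^sup>2)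
      \<le> savg K (\<lambda>\<tau>. \<theta> * w * X * (128 * exp (N \<tau> / 4) + 32 * exp (Y \<tau> / (4 * X))))"
      by (rule savg_mono) (rule pt)
    also have "\<dots> = \<theta> * w * X * (128 * savg K (\<lambda>\<tau>. exp (N \<tau> / 4)) + 32 * savg K (\<lambda>\<tau>. exp (Y \<tau> / (4 * X))))"
      by (simp only: savg_scale savg_add)
    also have "\<dots> \<le> \<theta> * w * X * (128 * 2 + 32 * 2)"
      using m1 m2 t w X by (intro mult_left_mono add_mono) auto
    finally show ?thesis by (simp add: X_def[symmetric] mult_ac)
  qed
qed

text \<open>Both directions rest on one cross moment, since exp y <= 1 + y exp y and, for y >= 0,
  exp(-y) >= 1 - y exp y. The unweighted second moment is exact because the cross terms average to
  zero.\<close>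

lemma savg_exp_weighted:
  assumes K: "finite K" and w: "0 < w" "(\<Sum>i\<in>K. inner_n r (u i) (u i)) \<le> w"
    and t: "0 \<le> \<theta>" "\<theta> * w \<le> 1 / 32"
  shows "savg K (\<lambda>\<tau>. exp (2 * \<theta> * inner_n r (comb K u \<tau>) (comb K u \<tau>)) * (inner_n r (comb K u \<tau>) x)\<^sup>2)
      \<le> (1 + 320 * \<theta> * w) * (\<Sum>i\<in>K. (inner_n r (u i) x)\<^sup>2)"  (is ?up)
    and "(1 - 320 * \<theta> * w) * (\<Sum>i\<in>K. (inner_n r (u i) x)\<^sup>2)
      \<le> savg K (\<lambda>\<tau>. exp (- 2 * \<theta> * inner_n r (comb K u \<tau>) (comb K u \<tau>)) * (inner_n r (comb K u \<tau>) x)\<^sup>2)"  (is ?low)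
proof -
  let ?z = "\<lambda>\<tau>. 2 * \<theta> * inner_n r (comb K u \<tau>) (comb K u \<tau>)"
  let ?y = "\<lambda>\<tau>. (inner_n r (comb K u \<tau>) x)\<^sup>2"
  have z: "0 \<le> ?z \<tau>" for \<tau> using t by (simp add: inner_n_nonneg)
  have up: "exp y \<le> 1 + y * exp y" for y :: real
    using exp_tangent[of y 0] by (simp add: algebra_simps)
  have low: "1 - y * exp y \<le> exp (-y)" if "0 \<le> y" for y :: real
  proof -
    have "y * 1 \<le> y * exp y" using that by (intro mult_left_mono) auto
    then show ?thesis using exp_ge_add_one_self[of "-y"] by simp
  qed
  note m = savg_cross_moment[OF assms, of x] and s = savg_second_moment[OF K, of r u x]
  have "savg K (\<lambda>\<tau>. exp (?z \<tau>) * ?y \<tau>) \<le> savg K (\<lambda>\<tau>. ?y \<tau> + ?z \<tau> * exp (?z \<tau>) * ?y \<tau>)"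
  proof (rule savg_mono)
    fix \<tau>
    show "exp (?z \<tau>) * ?y \<tau> \<le> ?y \<tau> + ?z \<tau> * exp (?z \<tau>) * ?y \<tau>"
      using mult_right_mono[OF up[of "?z \<tau>"], of "?y \<tau>"] by (simp add: distrib_right)
  qed
  then show ?up using m s by (simp add: savg_add distrib_right)
  have "savg K (\<lambda>\<tau>. ?y \<tau> - ?z \<tau> * exp (?z \<tau>) * ?y \<tau>) \<le> savg K (\<lambda>\<tau>. exp (- ?z \<tau>) * ?y \<tau>)"
  proof (rule savg_mono)
    fix \<tau>
    show "?y \<tau> - ?z \<tau> * exp (?z \<tau>) * ?y \<tau> \<le> exp (- ?z \<tau>) * ?y \<tau>"
      using mult_right_mono[OF low[OF z[of \<tau>]], of "?y \<tau>"] by (simp add: left_diff_distrib)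
  qed
  then show ?low using m s by (simp add: savg_diff left_diff_distrib)
qed

section \<open>Adding one sketch row to the exponent\<close>

lemma savg_expform:
  "savg K (\<lambda>\<tau>. g \<tau> * expform r A (v \<tau>))
    = (\<Sum>k<r. exp (eigval r A k) * savg K (\<lambda>\<tau>. g \<tau> * (inner_n r (v \<tau>) (eigvec r A k))\<^sup>2))"
  unfolding expform_def sum_distrib_left savg_sum savg_scale[symmetric]
  by (intro sum.cong savg_cong refl) (simp add: inner_n_commute mult_ac)

lemma sum_mult_left_commute: "(\<Sum>k\<in>F. e k * (c * z k)) = c * (\<Sum>k\<in>F. e k * z k :: real)"
  by (simp add: sum_distrib_left mult.left_commute)

lemma sum_expform:
  "(\<Sum>i\<in>K. expform r A (u i)) = (\<Sum>k<r. exp (eigval r A k) * (\<Sum>i\<in>K. (inner_n r (u i) (eigvec r A k))\<^sup>2))"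
  unfolding expform_def sum_distrib_left by (subst sum.swap) (simp add: inner_n_commute)

text \<open>Klein's inequality is used twice: to remove the deterministic compensator and to linearise
  the rank-one perturbation. It takes the place of the Golden-Thompson or Lieb inequality.\<close>

lemma trexp_step_upper:
  assumes H: "symm H" and K: "finite K" and w: "0 < w" "(\<Sum>i\<in>K. inner_n r (u i) (u i)) \<le> w"
    and t: "0 \<le> \<theta>" "\<theta> * w \<le> 1 / 32"
  shows "savg K (\<lambda>\<tau>. trexp r (\<lambda>a b. H a b + \<theta> * (comb K u \<tau> a * comb K u \<tau> b)
      - (\<Sum>i\<in>K. \<theta> * (1 + 320 * \<theta> * w) * (u i a * u i b)))) \<le> trexp r H"
proof -
  define c where "c = \<theta> * (1 + 320 * \<theta> * w)"
  define A where "A = (\<lambda>a b. H a b - (\<Sum>i\<in>K. c * (u i a * u i b)))"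
  have A: "symm A" using H by (simp add: symm_def A_def mult_ac)
  define M where "M \<tau> = (\<lambda>a b. A a b + \<theta> * (comb K u \<tau> a * comb K u \<tau> b))" for \<tau>
  have M: "symm (M \<tau>)" for \<tau> using A by (simp add: symm_def M_def mult_ac)
  have "trexp r (M \<tau>) \<le> trexp r A + \<theta> * (exp (2 * \<theta> * inner_n r (comb K u \<tau>) (comb K u \<tau>)) * expform r A (comb K u \<tau>))" for \<tau>
  proof -
    have "trexp r (M \<tau>) + (\<Sum>s\<in>{0::nat}. - \<theta> * expform r (M \<tau>) (comb K u \<tau>)) \<le> trexp r A"
      by (rule klein_rank_one_sum[OF M]) (simp add: M_def)
    moreover have "expform r (M \<tau>) (comb K u \<tau>)
        \<le> exp (2 * \<theta> * inner_n r (comb K u \<tau>) (comb K u \<tau>)) * expform r A (comb K u \<tau>)"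
      by (rule expform_rank_one_le[OF A t(1)]) (simp add: M_def)
    then have "\<theta> * expform r (M \<tau>) (comb K u \<tau>)
        \<le> \<theta> * (exp (2 * \<theta> * inner_n r (comb K u \<tau>) (comb K u \<tau>)) * expform r A (comb K u \<tau>))"
      using t by (intro mult_left_mono)
    ultimately show ?thesis by simp
  qed
  then have "savg K (\<lambda>\<tau>. trexp r (M \<tau>))
      \<le> savg K (\<lambda>\<tau>. trexp r A + \<theta> * (exp (2 * \<theta> * inner_n r (comb K u \<tau>) (comb K u \<tau>)) * expform r A (comb K u \<tau>)))"
    by (intro savg_mono)
  also have "\<dots> = trexp r A + \<theta> * savg K (\<lambda>\<tau>. exp (2 * \<theta> * inner_n r (comb K u \<tau>) (comb K u \<tau>)) * expform r A (comb K u \<tau>))"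
    by (simp only: savg_add savg_scale savg_const[OF K])
  also have "\<dots> \<le> trexp r A + \<theta> * ((1 + 320 * \<theta> * w) * (\<Sum>i\<in>K. expform r A (u i)))"
    unfolding savg_expform sum_expform sum_mult_left_commute[where c = "1 + 320 * \<theta> * w", symmetric]
    by (intro add_left_mono mult_left_mono sum_mono savg_exp_weighted(1)[OF K w t]) (use t in simp_all)
  also have "\<dots> = trexp r A + (\<Sum>i\<in>K. c * expform r A (u i))"
    by (simp add: c_def sum_distrib_left[symmetric] mult.assoc)
  also have "\<dots> \<le> trexp r H"
    by (rule klein_rank_one_sum[OF A]) (simp add: A_def)
  finally show ?thesis by (simp add: M_def A_def c_def algebra_simps)
qed

text \<open>Here the random term is subtracted, so \<open>expform_rank_one_le\<close> leads from
  \<open>M \<tau>\<close> up to \<open>A\<close> and must be inverted to bound the form of exp M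
  from below. This produces the weight exp(-2 \<theta> |v|^2) and calls for the second half of
  \<open>savg_exp_weighted\<close>.\<close>

lemma trexp_step_lower:
  assumes H: "symm H" and K: "finite K" and w: "0 < w" "(\<Sum>i\<in>K. inner_n r (u i) (u i)) \<le> w"
    and t: "0 \<le> \<theta>" "\<theta> * w \<le> 1 / 32"
  shows "savg K (\<lambda>\<tau>. trexp r (\<lambda>a b. H a b - \<theta> * (comb K u \<tau> a * comb K u \<tau> b)
      + (\<Sum>i\<in>K. \<theta> * (1 - 320 * \<theta> * w) * (u i a * u i b)))) \<le> trexp r H"
proof -
  define c where "c = \<theta> * (1 - 320 * \<theta> * w)"
  define A where "A = (\<lambda>a b. H a b + (\<Sum>i\<in>K. c * (u i a * u i b)))"
  have A: "symm A" using H by (simp add: symm_def A_def mult_ac)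
  define M where "M \<tau> = (\<lambda>a b. A a b - \<theta> * (comb K u \<tau> a * comb K u \<tau> b))" for \<tau>
  have M: "symm (M \<tau>)" for \<tau> using A by (simp add: symm_def M_def mult_ac)
  have "trexp r (M \<tau>) \<le> trexp r A - \<theta> * (exp (- 2 * \<theta> * inner_n r (comb K u \<tau>) (comb K u \<tau>)) * expform r A (comb K u \<tau>))" for \<tau>
  proof -
    let ?z = "2 * \<theta> * inner_n r (comb K u \<tau>) (comb K u \<tau>)"
    have "trexp r (M \<tau>) + (\<Sum>s\<in>{0::nat}. \<theta> * expform r (M \<tau>) (comb K u \<tau>)) \<le> trexp r A"
      by (rule klein_rank_one_sum[OF M]) (simp add: M_def)
    moreover have "expform r A (comb K u \<tau>) \<le> exp ?z * expform r (M \<tau>) (comb K u \<tau>)"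
      by (rule expform_rank_one_le[OF M t(1)]) (simp add: M_def)
    then have "exp (- ?z) * expform r A (comb K u \<tau>) \<le> exp (- ?z) * (exp ?z * expform r (M \<tau>) (comb K u \<tau>))"
      by (intro mult_left_mono) auto
    then have "exp (- ?z) * expform r A (comb K u \<tau>) \<le> expform r (M \<tau>) (comb K u \<tau>)"
      by (simp add: mult.assoc[symmetric] exp_add[symmetric])
    then have "\<theta> * (exp (- ?z) * expform r A (comb K u \<tau>)) \<le> \<theta> * expform r (M \<tau>) (comb K u \<tau>)"
      using t by (intro mult_left_mono)
    ultimately show ?thesis by simp
  qed
  then have "savg K (\<lambda>\<tau>. trexp r (M \<tau>))
      \<le> savg K (\<lambda>\<tau>. trexp r A - \<theta> * (exp (- 2 * \<theta> * inner_n r (comb K u \<tau>) (comb K u \<tau>)) * expform r A (comb K u \<tau>)))"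
    by (intro savg_mono)
  also have "\<dots> = trexp r A - \<theta> * savg K (\<lambda>\<tau>. exp (- 2 * \<theta> * inner_n r (comb K u \<tau>) (comb K u \<tau>)) * expform r A (comb K u \<tau>))"
    by (simp only: savg_diff savg_scale savg_const[OF K])
  also have "\<dots> \<le> trexp r A - \<theta> * ((1 - 320 * \<theta> * w) * (\<Sum>i\<in>K. expform r A (u i)))"
    unfolding savg_expform sum_expform sum_mult_left_commute[where c = "1 - 320 * \<theta> * w", symmetric]
    by (intro diff_left_mono mult_left_mono sum_mono savg_exp_weighted(2)[OF K w t]) (use t in simp_all)
  also have "\<dots> = trexp r A + (\<Sum>i\<in>K. - c * expform r A (u i))"
    by (simp add: c_def sum_distrib_left[symmetric] sum_negf mult.assoc)
  also have "\<dots> \<le> trexp r H"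
    by (rule klein_rank_one_sum[OF A]) (simp add: A_def sum_negf)
  finally show ?thesis by (simp add: M_def A_def c_def algebra_simps)
qed

subsection \<open>Concentration over the signs for a fixed hash\<close>

definition flip :: "nat set \<Rightarrow> (nat \<Rightarrow> real) \<Rightarrow> (nat \<Rightarrow> real) \<Rightarrow> nat \<Rightarrow> real" where
  "flip K \<tau> \<sigma> = (\<lambda>i. if i \<in> K then \<tau> i * \<sigma> i else \<sigma> i)"

lemma signsD: "\<sigma> \<in> signs J \<Longrightarrow> i \<in> J \<Longrightarrow> \<sigma> i * \<sigma> i = 1"
  by (auto simp: signs_def PiE_def Pi_def)

text \<open>For fixed \<tau> the flip is an involution of the signs on \<open>J\<close>, so
  averaging over \<tau> as well changes nothing. This is conditioning on the signs outside
  \<open>K\<close> without writing the sign space as a product.\<close>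

lemma savg_flip:
  assumes J: "finite J" and K: "K \<subseteq> J"
  shows "savg J F = savg J (\<lambda>\<sigma>. savg K (\<lambda>\<tau>. F (flip K \<tau> \<sigma>)))"
proof -
  have fK: "finite K" using J K finite_subset by blast
  have inv: "flip K \<tau> (flip K \<tau> \<sigma>) = \<sigma>" if "\<tau> \<in> signs K" for \<tau> \<sigma>
    using signsD[OF that] by (simp add: flip_def fun_eq_iff mult.assoc[symmetric])
  have cl: "flip K \<tau> \<sigma> \<in> signs J" if "\<tau> \<in> signs K" "\<sigma> \<in> signs J" for \<tau> \<sigma>
    using that K by (fastforce simp: flip_def signs_def PiE_def Pi_def extensional_def)
  have eq: "savg J (\<lambda>\<sigma>. F (flip K \<tau> \<sigma>)) = savg J F" if "\<tau> \<in> signs K" for \<tau>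
    unfolding savg_def using inv[OF that] cl[OF that]
    by (intro arg_cong2[of _ _ _ _ "(/)"] sum.reindex_bij_witness[of _ "flip K \<tau>" "flip K \<tau>"]) auto
  have "savg J (\<lambda>\<sigma>. savg K (\<lambda>\<tau>. F (flip K \<tau> \<sigma>))) = savg K (\<lambda>\<tau>. savg J (\<lambda>\<sigma>. F (flip K \<tau> \<sigma>)))"
    unfolding savg_def sum_divide_distrib by (subst sum.swap) (simp add: mult.commute)
  also have "\<dots> = savg K (\<lambda>\<tau>. savg J F)" by (rule savg_cong) (rule eq)
  also have "\<dots> = savg J F" by (rule savg_const[OF fK])
  finally show ?thesis ..
qed

definition bucket :: "nat set \<Rightarrow> (nat \<Rightarrow> nat) \<Rightarrow> nat \<Rightarrow> nat set" where
  "bucket J h k = {i \<in> J. h i = k}"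

text \<open>The exponent of the supermartingale after m rows. Free coefficients for the random part
  and for the compensator let one induction serve both tails.\<close>

definition row_sum :: "real \<Rightarrow> real \<Rightarrow> nat set \<Rightarrow> (nat \<Rightarrow> nat) \<Rightarrow> (nat \<Rightarrow> nat \<Rightarrow> real) \<Rightarrow> nat
    \<Rightarrow> (nat \<Rightarrow> real) \<Rightarrow> nat \<Rightarrow> nat \<Rightarrow> real" where
  "row_sum \<alpha> \<beta> J h u m \<sigma> = (\<lambda>a b.
     (\<Sum>k<m. \<alpha> * (comb (bucket J h k) u \<sigma> a * comb (bucket J h k) u \<sigma> b))
     + (\<Sum>i\<in>{i\<in>J. h i < m}. \<beta> * (u i a * u i b)))"

lemma symm_row_sum: "symm (row_sum \<alpha> \<beta> J h u m \<sigma>)"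
  by (simp add: symm_def row_sum_def mult_ac)

text \<open>The supermartingale step in a form common to both tails. It ranges over all u because
  the induction applies it to columns twisted by earlier signs.\<close>

definition step_ok :: "nat \<Rightarrow> real \<Rightarrow> real \<Rightarrow> real \<Rightarrow> bool" where
  "step_ok r w \<alpha> \<beta> \<longleftrightarrow> (\<forall>H K u. symm H \<longrightarrow> finite K \<longrightarrow> (\<Sum>i\<in>K. inner_n r (u i) (u i)) \<le> w \<longrightarrow>
     savg K (\<lambda>\<tau>. trexp r (\<lambda>a b. H a b + \<alpha> * (comb K u \<tau> a * comb K u \<tau> b)
       + (\<Sum>i\<in>K. \<beta> * (u i a * u i b)))) \<le> trexp r H)"

lemma step_ok_upper:
  assumes "0 < w" "0 \<le> \<theta>" "\<theta> * w \<le> 1 / 32"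
  shows "step_ok r w \<theta> (- (\<theta> * (1 + 320 * \<theta> * w)))"
  unfolding step_ok_def using trexp_step_upper[where r=r, OF _ _ assms(1) _ assms(2,3)] by (simp add: sum_negf)

lemma step_ok_lower:
  assumes "0 < w" "0 \<le> \<theta>" "\<theta> * w \<le> 1 / 32"
  shows "step_ok r w (- \<theta>) (\<theta> * (1 - 320 * \<theta> * w))"
  unfolding step_ok_def using trexp_step_lower[where r=r, OF _ _ assms(1) _ assms(2,3)] by simp

text \<open>Induction on the rows, starting from the trace r of the identity. Only the signs in the
  new bucket are refreshed; buckets are disjoint, so the earlier rows stay fixed.\<close>

lemma savg_trexp_row_sum:
  assumes J: "finite J" and ok: "step_ok r w \<alpha> \<beta>"
    and w: "\<And>k. (\<Sum>i\<in>bucket J h k. inner_n r (u i) (u i)) \<le> w"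
  shows "savg J (\<lambda>\<sigma>. trexp r (row_sum \<alpha> \<beta> J h u m \<sigma>)) \<le> real r"
proof (induction m)
  case 0
  have "row_sum \<alpha> \<beta> J h u 0 \<sigma> = (\<lambda>a b. 0)" for \<sigma> by (simp add: row_sum_def)
  then show ?case by (simp add: trexp_zero savg_const[OF J])
next
  case (Suc m)
  define K where "K = bucket J h m"
  have K: "K \<subseteq> J" "finite K" using J by (auto simp: K_def bucket_def)
  have "savg K (\<lambda>\<tau>. trexp r (row_sum \<alpha> \<beta> J h u (Suc m) (flip K \<tau> \<sigma>)))
      \<le> trexp r (row_sum \<alpha> \<beta> J h u m \<sigma>)" if \<sigma>: "\<sigma> \<in> signs J" for \<sigma>
  proof -
    \<comment> \<open>The old signs of the bucket are absorbed into the columns. They square to 1,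
      so the outer products, and with them the compensator and the load, are unchanged.\<close>
    define u' where "u' = (\<lambda>i a. \<sigma> i * u i a)"
    have sq: "\<sigma> i * \<sigma> i = 1" if "i \<in> K" for i using signsD[OF \<sigma>] that K by blast
    have uu: "u' i a * u' i b = u i a * u i b" if "i \<in> K" for i a b
    proof -
      have "u' i a * u' i b = (\<sigma> i * \<sigma> i) * (u i a * u i b)" by (simp add: u'_def)
      then show ?thesis using sq[OF that] by simp
    qed
    have "(\<Sum>i\<in>K. inner_n r (u' i) (u' i)) = (\<Sum>i\<in>K. inner_n r (u i) (u i))"
      unfolding inner_n_def by (intro sum.cong refl uu)
    then have "(\<Sum>i\<in>K. inner_n r (u' i) (u' i)) \<le> w" using w[of m] by (simp add: K_def)
    then have step: "savg K (\<lambda>\<tau>. trexp r (\<lambda>a b. row_sum \<alpha> \<beta> J h u m \<sigma> a b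
        + \<alpha> * (comb K u' \<tau> a * comb K u' \<tau> b) + (\<Sum>i\<in>K. \<beta> * (u' i a * u' i b))))
      \<le> trexp r (row_sum \<alpha> \<beta> J h u m \<sigma>)"
      using ok symm_row_sum K(2) unfolding step_ok_def by blast
    have "row_sum \<alpha> \<beta> J h u (Suc m) (flip K \<tau> \<sigma>) = (\<lambda>a b. row_sum \<alpha> \<beta> J h u m \<sigma> a b
        + \<alpha> * (comb K u' \<tau> a * comb K u' \<tau> b) + (\<Sum>i\<in>K. \<beta> * (u' i a * u' i b)))" for \<tau>
    proof -
      have old: "comb (bucket J h k) u (flip K \<tau> \<sigma>) = comb (bucket J h k) u \<sigma>" if "k < m" for k
        unfolding comb_def using that
        by (intro ext sum.cong refl) (auto simp: flip_def K_def bucket_def)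
      have new: "comb K u (flip K \<tau> \<sigma>) = comb K u' \<tau>"
        unfolding comb_def by (intro ext sum.cong refl) (auto simp: flip_def u'_def)
      have "{i \<in> J. h i < Suc m} = {i \<in> J. h i < m} \<union> K" "{i \<in> J. h i < m} \<inter> K = {}"
        by (auto simp: K_def bucket_def)
      then have split: "(\<Sum>i\<in>{i\<in>J. h i < Suc m}. g i) = (\<Sum>i\<in>{i\<in>J. h i < m}. g i) + (\<Sum>i\<in>K. g i)" for g :: "nat \<Rightarrow> real"
        using J K by (simp add: sum.union_disjoint)
      show ?thesis
        unfolding row_sum_def split by (simp add: old K_def[symmetric] new uu add_ac)
    qed
    then show ?thesis using step by simp
  qed
  then have "savg J (\<lambda>\<sigma>. savg K (\<lambda>\<tau>. trexp r (row_sum \<alpha> \<beta> J h u (Suc m) (flip K \<tau> \<sigma>))))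
      \<le> savg J (\<lambda>\<sigma>. trexp r (row_sum \<alpha> \<beta> J h u m \<sigma>))"
    by (rule savg_mono)
  then show ?case using Suc savg_flip[OF J K(1), of "\<lambda>\<sigma>. trexp r (row_sum \<alpha> \<beta> J h u (Suc m) \<sigma>)"] by simp
qed

text \<open>Markov's inequality in counting form. The quantifier over x can stay inside the event
  because one trace dominates the exponential of the form at every unit x.\<close>

lemma row_sum_tail:
  assumes J: "finite J" and h: "\<And>i. i \<in> J \<Longrightarrow> h i < m" and ok: "step_ok r w \<alpha> \<beta>"
    and w: "\<And>k. (\<Sum>i\<in>bucket J h k. inner_n r (u i) (u i)) \<le> w"
  shows "real (card {\<sigma> \<in> signs J. \<exists>x. inner_n r x x = 1 \<and>
      s \<le> \<alpha> * (\<Sum>k<m. (inner_n r (comb (bucket J h k) u \<sigma>) x)\<^sup>2) + \<beta> * (\<Sum>i\<in>J. (inner_n r (u i) x)\<^sup>2)})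
    \<le> real r * exp (- s) * 2 ^ card J"  (is "real (card ?B) \<le> _")
proof -
  let ?T = "\<lambda>\<sigma>. trexp r (row_sum \<alpha> \<beta> J h u m \<sigma>)"
  have big: "exp s \<le> ?T \<sigma>" if \<sigma>: "\<sigma> \<in> ?B" for \<sigma>
  proof -
    obtain x where x: "inner_n r x x = 1"
      and s: "s \<le> \<alpha> * (\<Sum>k<m. (inner_n r (comb (bucket J h k) u \<sigma>) x)\<^sup>2) + \<beta> * (\<Sum>i\<in>J. (inner_n r (u i) x)\<^sup>2)"
      using \<sigma> by blast
    have J': "{i \<in> J. h i < m} = J" using h by auto
    let ?Z = "\<lambda>a b. \<Sum>k<m. \<alpha> * (comb (bucket J h k) u \<sigma> a * comb (bucket J h k) u \<sigma> b)"
    have "inner_n r x (mv r (row_sum \<alpha> \<beta> J h u m \<sigma>) x)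
        = inner_n r x (mv r ?Z x) + (\<Sum>i\<in>J. \<beta> * (inner_n r (u i) x * inner_n r (u i) x))"
      by (rule mv_rank_one_sum) (simp add: row_sum_def J')
    also have "inner_n r x (mv r ?Z x) = inner_n r x (mv r (\<lambda>a b. 0) x)
        + (\<Sum>k<m. \<alpha> * (inner_n r (comb (bucket J h k) u \<sigma>) x * inner_n r (comb (bucket J h k) u \<sigma>) x))"
      by (rule mv_rank_one_sum) simp
    also have "inner_n r x (mv r (\<lambda>a b. 0) x) = 0" by (simp add: mv_def inner_n_def)
    finally have "s \<le> inner_n r x (mv r (row_sum \<alpha> \<beta> J h u m \<sigma>) x)"
      using s by (simp add: sum_distrib_left power2_eq_square)
    then have "exp s \<le> exp (inner_n r x (mv r (row_sum \<alpha> \<beta> J h u m \<sigma>) x))" by simp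
    also have "\<dots> \<le> ?T \<sigma>" by (rule exp_quadform_le_trexp[OF symm_row_sum x])
    finally show ?thesis .
  qed
  have "real (card ?B) * exp s = (\<Sum>\<sigma>\<in>?B. exp s)" by simp
  also have "\<dots> \<le> (\<Sum>\<sigma>\<in>?B. ?T \<sigma>)" by (rule sum_mono) (rule big)
  also have "\<dots> \<le> (\<Sum>\<sigma>\<in>signs J. ?T \<sigma>)"
    using finite_signs[OF J] by (intro sum_mono2) (auto simp: trexp_def sum_nonneg)
  also have "\<dots> = savg J ?T * 2 ^ card J" by (simp add: savg_def)
  also have "\<dots> \<le> real r * 2 ^ card J"
    by (intro mult_right_mono savg_trexp_row_sum[OF J ok w]) simp
  finally have "real (card ?B) \<le> real r * 2 ^ card J / exp s" by (simp add: pos_le_divide_eq)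
  then show ?thesis by (simp add: exp_minus divide_inverse mult_ac)
qed

lemma sketch_tail:
  assumes J: "finite J" and h: "\<And>i. i \<in> J \<Longrightarrow> h i < m"
    and w: "0 < w" "\<And>k. (\<Sum>i\<in>bucket J h k. inner_n r (u i) (u i)) \<le> w"
    and iso: "\<And>x. (\<Sum>i\<in>J. (inner_n r (u i) x)\<^sup>2) \<le> inner_n r x x"
    and e: "0 < \<epsilon>" "\<epsilon> < 1"
  shows "real (card {\<sigma> \<in> signs J. \<exists>x. \<epsilon> * inner_n r x x <
      \<bar>(\<Sum>k<m. (inner_n r (comb (bucket J h k) u \<sigma>) x)\<^sup>2) - (\<Sum>i\<in>J. (inner_n r (u i) x)\<^sup>2)\<bar>})
    \<le> 2 * real r * exp (- (\<epsilon>\<^sup>2 / (1280 * w))) * 2 ^ card J"  (is "real (card ?B) \<le> _")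
proof -
  \<comment> \<open>This choice makes 320 \<theta> w = \<epsilon>/2. By \<open>iso\<close> the
    compensator error then uses at most half of \<epsilon>, and the other half leaves the exponent s
    = \<theta> \<epsilon>/2.\<close>
  define \<theta> where "\<theta> = \<epsilon> / (640 * w)"
  define s where "s = \<epsilon>\<^sup>2 / (1280 * w)"
  have t: "0 \<le> \<theta>" "\<theta> * w \<le> 1 / 32" using e w by (auto simp: \<theta>_def)
  have eta: "320 * \<theta> * w = \<epsilon> / 2" using w by (simp add: \<theta>_def)
  have s: "s = \<theta> * (\<epsilon> / 2)" using w by (simp add: s_def \<theta>_def power2_eq_square)
  let ?P = "\<lambda>\<sigma> x. \<Sum>k<m. (inner_n r (comb (bucket J h k) u \<sigma>) x)\<^sup>2"
  let ?Q = "\<lambda>x. \<Sum>i\<in>J. (inner_n r (u i) x)\<^sup>2"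
  let ?B1 = "{\<sigma> \<in> signs J. \<exists>x. inner_n r x x = 1 \<and> s \<le> \<theta> * ?P \<sigma> x + - (\<theta> * (1 + 320 * \<theta> * w)) * ?Q x}"
  let ?B2 = "{\<sigma> \<in> signs J. \<exists>x. inner_n r x x = 1 \<and> s \<le> - \<theta> * ?P \<sigma> x + \<theta> * (1 - 320 * \<theta> * w) * ?Q x}"
  have "?B \<subseteq> ?B1 \<union> ?B2"
  proof
    fix \<sigma> assume "\<sigma> \<in> ?B"
    then obtain y where \<sigma>: "\<sigma> \<in> signs J" and y: "\<epsilon> * inner_n r y y < \<bar>?P \<sigma> y - ?Q y\<bar>" by blast
    have "inner_n r y y \<noteq> 0"
    proof
      assume "inner_n r y y = 0"
      then have "inner_n r z y = 0" for z by (simp add: inner_n_eq_0_iff) (simp add: inner_n_def)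
      then show False using y by simp
    qed
    then have yy: "inner_n r y y > 0" using inner_n_nonneg[of r y] by simp
    define N where "N = sqrt (inner_n r y y)"
    have N: "N > 0" "N\<^sup>2 = inner_n r y y" using yy by (auto simp: N_def)
    define x where "x = (\<lambda>i. inverse N * y i)"
    have sc: "inner_n r z x = inverse N * inner_n r z y" for z by (simp add: x_def inner_n_scale_right)
    have x1: "inner_n r x x = 1"
      unfolding x_def inner_n_scale_left inner_n_scale_right N(2)[symmetric] using N(1) by (simp add: power2_eq_square field_simps)
    have PQ: "?P \<sigma> x = ?P \<sigma> y / N\<^sup>2" "?Q x = ?Q y / N\<^sup>2"
      unfolding sc by (simp_all add: power_mult_distrib sum_distrib_left power_inverse divide_inverse mult.commute)
    have "\<epsilon> < \<bar>?P \<sigma> y - ?Q y\<bar> / N\<^sup>2" using y N yy by (simp add: pos_less_divide_eq)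
    also have "\<dots> = \<bar>?P \<sigma> x - ?Q x\<bar>"
      unfolding PQ diff_divide_distrib[symmetric] by simp
    finally have d: "\<epsilon> < \<bar>?P \<sigma> x - ?Q x\<bar>" .
    have Q1: "?Q x \<le> 1" using iso[of x] x1 by simp
    have eQ: "\<epsilon> / 2 * ?Q x \<le> \<epsilon> / 2" using Q1 e by simp
    show "\<sigma> \<in> ?B1 \<union> ?B2"
    proof (cases "?P \<sigma> x - ?Q x > \<epsilon>")
      case True
      have "s \<le> \<theta> * (?P \<sigma> x - ?Q x - \<epsilon> / 2 * ?Q x)"
        unfolding s using True eQ t by (intro mult_left_mono) auto
      then have "\<sigma> \<in> ?B1" using \<sigma> x1 unfolding eta by (auto simp: algebra_simps intro!: exI[of _ x])
      then show ?thesis ..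
    next
      case False
      then have "?Q x - ?P \<sigma> x > \<epsilon>" using d by linarith
      then have "s \<le> \<theta> * (?Q x - ?P \<sigma> x - \<epsilon> / 2 * ?Q x)"
        unfolding s using eQ t by (intro mult_left_mono) auto
      then have "\<sigma> \<in> ?B2" using \<sigma> x1 unfolding eta by (auto simp: algebra_simps intro!: exI[of _ x])
      then show ?thesis ..
    qed
  qed
  then have "card ?B \<le> card (?B1 \<union> ?B2)"
    using finite_signs[OF J] by (intro card_mono) auto
  also have "\<dots> \<le> card ?B1 + card ?B2" by (rule card_Un_le)
  finally have "real (card ?B) \<le> real (card ?B1) + real (card ?B2)" by linarith
  also have "\<dots> \<le> real r * exp (- s) * 2 ^ card J + real r * exp (- s) * 2 ^ card J"
    by (intro add_mono row_sum_tail[OF J h _ w(2)] step_ok_upper step_ok_lower w(1) t)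
  finally show ?thesis unfolding s_def by (simp only: mult.assoc mult_2[symmetric])
qed

subsection \<open>The column space in orthonormal coordinates\<close>

definition combs :: "nat \<Rightarrow> (nat \<Rightarrow> nat \<Rightarrow> real) \<Rightarrow> (nat \<Rightarrow> real) set" where
  "combs r q = range (\<lambda>c i. \<Sum>k<r. c k * q k i)"

lemma combs_Suc: "x \<in> combs (Suc r) q \<longleftrightarrow> (\<exists>y\<in>combs r q. \<exists>t. x = (\<lambda>i. y i + t * q r i))"
proof
  assume "x \<in> combs (Suc r) q"
  then show "\<exists>y\<in>combs r q. \<exists>t. x = (\<lambda>i. y i + t * q r i)"
    by (auto simp: combs_def)
next
  assume "\<exists>y\<in>combs r q. \<exists>t. x = (\<lambda>i. y i + t * q r i)"
  then obtain c t where "x = (\<lambda>i. (\<Sum>k<r. c k * q k i) + t * q r i)"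
    by (auto simp: combs_def)
  then have "x = (\<lambda>i. \<Sum>k<Suc r. (c(r := t)) k * q k i)" by (simp add: fun_eq_iff)
  then show "x \<in> combs (Suc r) q" unfolding combs_def by blast
qed

lemma combs_add:
  assumes "x \<in> combs r q" "y \<in> combs r q"
  shows "(\<lambda>i. x i + t * y i) \<in> combs r q"
proof -
  obtain c e where "x = (\<lambda>i. \<Sum>k<r. c k * q k i)" "y = (\<lambda>i. \<Sum>k<r. e k * q k i)"
    using assms by (auto simp: combs_def)
  then have "(\<lambda>i. x i + t * y i) = (\<lambda>i. \<Sum>k<r. (c k + t * e k) * q k i)"
    by (simp add: sum.distrib sum_distrib_left algebra_simps)
  then show ?thesis unfolding combs_def by (rule range_eqI[of _ _ "\<lambda>k. c k + t * e k"])
qed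

lemma colspace_Suc:
  "x \<in> colspace n (Suc d) A \<longleftrightarrow>
    (\<exists>y\<in>colspace n d A. \<exists>t. x = (\<lambda>i. y i + t * (if i < n then A i d else 0)))"
proof
  assume "x \<in> colspace n (Suc d) A"
  then obtain c where c: "\<forall>i. x i = (if i < n then (\<Sum>j<Suc d. A i j * c j) else 0)"
    by (auto simp: colspace_def)
  let ?y = "\<lambda>i. if i < n then (\<Sum>j<d. A i j * c j) else 0"
  have "?y \<in> colspace n d A" by (auto simp: colspace_def)
  moreover have "x = (\<lambda>i. ?y i + c d * (if i < n then A i d else 0))"
    using c by (auto simp: fun_eq_iff)
  ultimately show "\<exists>y\<in>colspace n d A. \<exists>t. x = (\<lambda>i. y i + t * (if i < n then A i d else 0))"
    by (intro bexI[of _ ?y] exI[of _ "c d"])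
next
  assume "\<exists>y\<in>colspace n d A. \<exists>t. x = (\<lambda>i. y i + t * (if i < n then A i d else 0))"
  then obtain y t where y: "y \<in> colspace n d A" and x: "x = (\<lambda>i. y i + t * (if i < n then A i d else 0))"
    by blast
  from y obtain c where "\<forall>i. y i = (if i < n then (\<Sum>j<d. A i j * c j) else 0)"
    by (auto simp: colspace_def)
  with x have "\<forall>i. x i = (if i < n then (\<Sum>j<d. A i j * c j) else 0) + t * (if i < n then A i d else 0)"
    by simp
  then have "\<forall>i. x i = (if i < n then (\<Sum>j<Suc d. A i j * (c(d := t)) j) else 0)"
    by simp
  then show "x \<in> colspace n (Suc d) A" unfolding colspace_def by blast
qed

text \<open>Gram-Schmidt, one column at a time; a dependent column leaves the system unchanged,
  whence r <= d. The basis vanishes from n on because the elements of \<open>colspace\<close> do,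
  and the two sets of functions are to be equal.\<close>

lemma colspace_orthonormal_basis:
  "\<exists>r q. r \<le> d \<and> orthonormal n r q \<and> (\<forall>k<r. \<forall>i\<ge>n. q k i = 0) \<and> colspace n d A = combs r q"
proof (induction d)
  case 0
  have "colspace n 0 A = combs 0 (\<lambda>_ _. 0)" by (auto simp: colspace_def combs_def)
  then show ?case by (auto simp: orthonormal_def intro!: exI[of _ 0])
next
  case (Suc d)
  then obtain r q where r: "r \<le> d" and q: "orthonormal n r q" and q0: "\<forall>k<r. \<forall>i\<ge>n. q k i = 0"
    and col: "colspace n d A = combs r q" by blast
  define a where "a i = (if i < n then A i d else 0)" for i
  define z where "z = residual n r q a"
  define p where "p = (\<lambda>i. \<Sum>k<r. inner_n n (q k) a * q k i)"
  have p: "p \<in> combs r q" by (auto simp: p_def combs_def)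
  have az: "a i = p i + z i" for i by (simp add: z_def residual_def p_def)
  have z0: "z i = 0" if "i \<ge> n" for i using that q0 by (simp add: z_def residual_def a_def)
  have colS: "x \<in> colspace n (Suc d) A \<longleftrightarrow> (\<exists>y\<in>combs r q. \<exists>t. x = (\<lambda>i. y i + t * a i))" for x
    unfolding colspace_Suc col a_def ..
  show ?case
  proof (cases "inner_n n z z = 0")
    case True
    then have "z i = 0" for i using z0 by (cases "i < n") (auto simp: inner_n_eq_0_iff)
    then have ap: "a = p" using az by (simp add: fun_eq_iff)
    have "x \<in> colspace n (Suc d) A \<longleftrightarrow> x \<in> combs r q" for x
    proof
      assume "x \<in> colspace n (Suc d) A"
      then show "x \<in> combs r q" unfolding colS ap using combs_add[OF _ p] by blast
    next
      assume "x \<in> combs r q"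
      then show "x \<in> colspace n (Suc d) A" unfolding colS by (intro bexI[of _ x] exI[of _ 0]) auto
    qed
    then have "colspace n (Suc d) A = combs r q" by blast
    then show ?thesis using r q q0 by (intro exI[of _ r] exI[of _ q]) auto
  next
    case False
    define N where "N = sqrt (inner_n n z z)"
    have N: "N > 0" "N * N = inner_n n z z"
      using False inner_n_nonneg[of n z] by (auto simp: N_def less_le)
    define b where "b = (\<lambda>i. inverse N * z i)"
    have bb: "inner_n n b b = 1"
      unfolding b_def inner_n_scale_left inner_n_scale_right N(2)[symmetric] using N(1) by (simp add: field_simps)
    have qb: "inner_n n (q k) b = 0" if "k < r" for k
      using residual_orthogonal[OF q that] by (simp add: b_def inner_n_scale_right z_def)
    then have bq: "inner_n n b (q k) = 0" if "k < r" for k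
      using that by (subst inner_n_commute) simp
    define q' where "q' = q(r := b)"
    have "orthonormal n (Suc r) q'"
      using q bb qb bq unfolding orthonormal_def q'_def by (auto simp: less_Suc_eq)
    moreover have "\<forall>k<Suc r. \<forall>i\<ge>n. q' k i = 0"
      using q0 z0 by (auto simp: q'_def b_def less_Suc_eq)
    moreover have "colspace n (Suc d) A = combs (Suc r) q'"
    proof -
      have cq: "combs r q' = combs r q"
        unfolding combs_def q'_def by (intro image_cong refl ext sum.cong) auto
      have ab: "a i = p i + N * b i" for i using N by (simp add: az b_def)
      have "x \<in> colspace n (Suc d) A \<longleftrightarrow> x \<in> combs (Suc r) q'" for x
        unfolding colS combs_Suc cq
      proof
        assume "\<exists>y\<in>combs r q. \<exists>t. x = (\<lambda>i. y i + t * a i)"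
        then obtain y t where y: "y \<in> combs r q" and x: "x = (\<lambda>i. y i + t * a i)" by blast
        have "x = (\<lambda>i. (y i + t * p i) + (t * N) * q' r i)"
          by (simp add: x ab q'_def algebra_simps)
        then show "\<exists>y\<in>combs r q. \<exists>t. x = (\<lambda>i. y i + t * q' r i)"
          using combs_add[OF y p, of t] by (intro bexI[of _ "\<lambda>i. y i + t * p i"] exI[of _ "t * N"])
      next
        assume "\<exists>y\<in>combs r q. \<exists>t. x = (\<lambda>i. y i + t * q' r i)"
        then obtain y t where y: "y \<in> combs r q" and x: "x = (\<lambda>i. y i + t * q' r i)" by blast
        have "x = (\<lambda>i. (y i + (- t / N) * p i) + (t / N) * a i)"
          using N(1) by (simp add: x ab q'_def fun_eq_iff distrib_left)
        then show "\<exists>y\<in>combs r q. \<exists>t. x = (\<lambda>i. y i + t * a i)"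
          using combs_add[OF y p, of "- t / N"]
            by (intro bexI[of _ "\<lambda>i. y i + (- t / N) * p i"] exI[of _ "t / N"])
      qed
      then show ?thesis by blast
    qed
    ultimately show ?thesis using r by (intro exI[of _ "Suc r"] exI[of _ q']) auto
  qed
qed

text \<open>The \<open>THE\<close> in \<open>orth_proj_col\<close> calls for uniqueness: the
  difference of two candidates lies in the column space and is orthogonal to it, hence to itself, so
  it vanishes below n; from n on every element of the column space is 0.\<close>

lemma leverage_eq:
  assumes q: "orthonormal n r q" and q0: "\<forall>k<r. \<forall>i\<ge>n. q k i = 0"
    and col: "colspace n d A = combs r q" and i: "i < n"
  shows "leverage n d A i = (\<Sum>k<r. (q k i)\<^sup>2)"
proof -
  define e where "e = (\<lambda>k. if k = i then 1 else 0 :: real)"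
  define p where "p = (\<lambda>j. \<Sum>k<r. q k i * q k j)"
  have p: "p \<in> combs r q" by (auto simp: p_def combs_def)
  have orth: "inner_n n (\<lambda>j. e j - p j) y = 0" if y: "y \<in> combs r q" for y
  proof -
    obtain c where y: "y = (\<lambda>j. \<Sum>k<r. c k * q k j)" using y by (auto simp: combs_def)
    have "inner_n n (\<lambda>j. e j - p j) (q k) = 0" if k: "k < r" for k
    proof -
      have "inner_n n p (q k) = q k i"
        unfolding p_def by (subst inner_n_commute) (rule orthonormal_comb[OF q k])
      then show ?thesis using i by (simp add: inner_n_diff_left e_def inner_n_delta_left)
    qed
    then show ?thesis unfolding y by (simp add: inner_n_sum_right inner_n_scale_right)
  qed
  have "orth_proj_col n d A e = p"
    unfolding orth_proj_col_def col
  proof (rule the_equality)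
    show "p \<in> combs r q \<and> (\<forall>y\<in>combs r q. inner_n n (\<lambda>i. e i - p i) y = 0)" using p orth by blast
  next
    fix p' assume p': "p' \<in> combs r q \<and> (\<forall>y\<in>combs r q. inner_n n (\<lambda>i. e i - p' i) y = 0)"
    define g where "g = (\<lambda>j. p j + (-1) * p' j)"
    have g: "g \<in> combs r q" unfolding g_def using combs_add[OF p, of p'] p' by blast
    have "inner_n n g g = inner_n n (\<lambda>i. e i - p' i) g - inner_n n (\<lambda>i. e i - p i) g"
      by (simp add: g_def inner_n_diff_left[symmetric] inner_n_def sum_subtractf[symmetric] algebra_simps)
    then have "inner_n n g g = 0" using g p' orth by simp
    then have "p' j = p j" if "j < n" for j using that by (simp add: inner_n_eq_0_iff g_def)
    moreover have "y j = 0" if "j \<ge> n" "y \<in> combs r q" for y j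
      using that q0 by (auto simp: combs_def)
    ultimately show "p' = p" using p p' by (intro ext) (metis not_le)
  qed
  then show ?thesis by (simp add: leverage_def e_def[symmetric]) (simp add: p_def power2_eq_square)
qed

section \<open>The squared norm of a sketched vector\<close>

lemma sum_lessThan_add:
  fixes a m :: nat
  shows "(\<Sum>k<a + m. f k) = (\<Sum>k<a. f k) + (\<Sum>k<m. f (a + k) :: real)"
  by (induction m) auto

lemma sqnorm_sketch_apply:
  assumes I: "I \<subseteq> {0..<n}"
  shows "sqnorm_n (card I + m) (sketch_apply n I m (h, \<sigma>) x)
    = (\<Sum>i\<in>I. (x i)\<^sup>2) + (\<Sum>k<m. (\<Sum>j\<in>bucket ({0..<n} - I) h k. \<sigma> j * x j)\<^sup>2)"
proof -
  have fI: "finite I" using I finite_subset by blast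
  let ?s = "sketch_apply n I m (h, \<sigma>) x"
  have "(\<Sum>k<card I. (?s k)\<^sup>2) = (\<Sum>k<card I. (x (sorted_list_of_set I ! k))\<^sup>2)"
    by (simp add: sketch_apply_def)
  also have "\<dots> = (\<Sum>i\<in>I. (x i)\<^sup>2)"
    using fI by (intro sum.reindex_bij_betw[of "(!) (sorted_list_of_set I)"] bij_betw_nth) auto
  finally have 1: "(\<Sum>k<card I. (?s k)\<^sup>2) = (\<Sum>i\<in>I. (x i)\<^sup>2)" .
  have 2: "?s (card I + k) = (\<Sum>j\<in>bucket ({0..<n} - I) h k. \<sigma> j * x j)" if "k < m" for k
  proof -
    have "?s (card I + k) = (\<Sum>j\<in>{0..<n} - I. if h j = k then \<sigma> j * x j else 0)"
      using that by (auto simp: sketch_apply_def cs_mat_def intro!: sum.cong)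
    also have "\<dots> = (\<Sum>j\<in>bucket ({0..<n} - I) h k. \<sigma> j * x j)"
      unfolding bucket_def by (rule sum.inter_filter[symmetric]) simp
    finally show ?thesis .
  qed
  show ?thesis unfolding sqnorm_n_def sum_lessThan_add 1 by (simp add: 2)
qed

text \<open>In coordinates with respect to an orthonormal basis of the column space, only the rows
  outside I contribute to the distortion.\<close>

lemma sketch_distortion:
  assumes q: "orthonormal n r q" and I: "I \<subseteq> {0..<n}"
    and x: "x = (\<lambda>i. \<Sum>k<r. c k * q k i)"
  defines "u \<equiv> \<lambda>i k. q k i"
  shows "sqnorm_n n x = inner_n r c c"
    and "sqnorm_n (card I + m) (sketch_apply n I m (h, \<sigma>) x) - sqnorm_n n x
      = (\<Sum>k<m. (inner_n r (comb (bucket ({0..<n} - I) h k) u \<sigma>) c)\<^sup>2)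
        - (\<Sum>i\<in>{0..<n} - I. (inner_n r (u i) c)\<^sup>2)"
proof -
  have xi: "x i = inner_n r (u i) c" for i by (simp add: x u_def inner_n_def mult.commute)
  have "sqnorm_n n x = inner_n n x x" by (simp add: sqnorm_n_def inner_n_def power2_eq_square)
  also have "\<dots> = (\<Sum>k<r. c k * inner_n n (q k) x)"
    by (subst (1) x) (simp add: inner_n_sum_left inner_n_scale_left)
  also have "\<dots> = inner_n r c c"
    unfolding inner_n_def[of r] by (intro sum.cong refl) (simp add: x orthonormal_comb[OF q])
  finally show "sqnorm_n n x = inner_n r c c" .
  have "sqnorm_n n x = (\<Sum>i\<in>I. (x i)\<^sup>2) + (\<Sum>i\<in>{0..<n} - I. (x i)\<^sup>2)"
    unfolding sqnorm_n_def lessThan_atLeast0 using sum.subset_diff[OF I] by (simp add: add.commute)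
  then show "sqnorm_n (card I + m) (sketch_apply n I m (h, \<sigma>) x) - sqnorm_n n x
      = (\<Sum>k<m. (inner_n r (comb (bucket ({0..<n} - I) h k) u \<sigma>) c)\<^sup>2)
        - (\<Sum>i\<in>{0..<n} - I. (inner_n r (u i) c)\<^sup>2)"
    unfolding sqnorm_sketch_apply[OF I] by (simp add: inner_n_comb_left xi)
qed

subsection \<open>Concentration over the hash\<close>

text \<open>A Chernoff bound at rate 1/b, which keeps every t i / b in [0, 1], where exp s <= 1 + 2
  s. Independence of the hash values is the product formula for sums over \<open>PiE\<close>; in
  each factor only one of the m values differs from 1. The prefactor m is the union bound over the
  rows.\<close>

lemma hash_load_tail:
  assumes J: "finite J" and m: "0 < m" and b: "0 < b"
    and t: "\<And>i. i \<in> J \<Longrightarrow> 0 \<le> t i \<and> t i \<le> b" and D: "(\<Sum>i\<in>J. t i) \<le> D"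
  shows "real (card {h \<in> PiE J (\<lambda>_. {0..<m}). \<exists>k<m. w < (\<Sum>i\<in>bucket J h k. t i)})
    \<le> real m * exp (2 * D / (b * m) - w / b) * real m ^ card J"  (is "real (card ?B) \<le> _")
proof -
  let ?H = "PiE J (\<lambda>_. {0..<m})"
  let ?B' = "\<lambda>k. {h \<in> ?H. w < (\<Sum>i\<in>bucket J h k. t i)}"
  have fH: "finite ?H" using J by (intro finite_PiE) auto
  have one: "real (card (?B' k)) \<le> exp (2 * D / (b * m) - w / b) * real m ^ card J" if k: "k < m" for k
  proof -
    let ?f = "\<lambda>i y. exp ((if y = k then t i else 0) / b)"
    have load: "exp ((\<Sum>i\<in>bucket J h k. t i) / b) = (\<Prod>i\<in>J. ?f i (h i))" for h
      unfolding bucket_def by (simp add: exp_sum[OF J, symmetric] sum_divide_distrib sum.inter_filter[OF J] if_distrib[of "\<lambda>x. x / b"] cong: if_cong)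
    have factor: "(\<Sum>y\<in>{0..<m}. ?f i y) \<le> real m * exp (2 * t i / (b * m))" if i: "i \<in> J" for i
    proof -
      have s: "0 \<le> t i / b" "t i / b \<le> 1" using t[OF i] b by auto
      have "(t i / b)\<^sup>2 \<le> t i / b" unfolding power2_eq_square by (rule mult_left_le[OF s(2) s(1)])
      then have e: "exp (t i / b) \<le> 1 + 2 * (t i / b)" using exp_bound[OF s] by simp
      have "(\<Sum>y\<in>{0..<m}. ?f i y) = ?f i k + (\<Sum>y\<in>{0..<m} - {k}. ?f i y)"
        using k by (intro sum.remove) auto
      also have "(\<Sum>y\<in>{0..<m} - {k}. ?f i y) = (\<Sum>y\<in>{0..<m} - {k}. 1)"
        by (intro sum.cong) auto
      also have "\<dots> = real m - 1" using k by (simp add: of_nat_diff)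
      finally have "(\<Sum>y\<in>{0..<m}. ?f i y) \<le> real m + 2 * (t i / b)" using e by simp
      also have "\<dots> = real m * (1 + 2 * t i / (b * m))" using m b by (simp add: field_simps)
      also have "\<dots> \<le> real m * exp (2 * t i / (b * m))"
        by (intro mult_left_mono exp_ge_add_one_self) simp
      finally show ?thesis .
    qed
    have "real (card (?B' k)) * exp (w / b) = (\<Sum>h\<in>?B' k. exp (w / b))" by simp
    also have "\<dots> \<le> (\<Sum>h\<in>?B' k. exp ((\<Sum>i\<in>bucket J h k. t i) / b))"
      using b by (intro sum_mono) (simp add: divide_right_mono)
    also have "\<dots> \<le> (\<Sum>h\<in>?H. exp ((\<Sum>i\<in>bucket J h k. t i) / b))"
      using fH by (intro sum_mono2) auto
    also have "\<dots> = (\<Prod>i\<in>J. \<Sum>y\<in>{0..<m}. ?f i y)"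
      unfolding load using J by (intro prod_sum_PiE[symmetric]) auto
    also have "\<dots> \<le> (\<Prod>i\<in>J. real m * exp (2 * t i / (b * m)))"
      using factor by (intro prod_mono conjI) (auto intro: sum_nonneg)
    also have "\<dots> = real m ^ card J * exp (2 * (\<Sum>i\<in>J. t i) / (b * m))"
      using J by (simp add: prod.distrib exp_sum[symmetric] sum_divide_distrib sum_distrib_left)
    also have "\<dots> \<le> real m ^ card J * exp (2 * D / (b * m))"
      using D b m by (intro mult_left_mono) (auto intro!: divide_right_mono)
    finally have "real (card (?B' k)) \<le> real m ^ card J * exp (2 * D / (b * m)) / exp (w / b)"
      by (simp add: pos_le_divide_eq)
    then show ?thesis by (simp add: exp_diff mult.commute)
  qed
  have "?B = (\<Union>k<m. ?B' k)" by auto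
  then have "card ?B \<le> (\<Sum>k<m. card (?B' k))" using card_UN_le[of "{..<m}" ?B'] by simp
  then have "real (card ?B) \<le> real (\<Sum>k<m. card (?B' k))" by (rule of_nat_mono)
  also have "\<dots> = (\<Sum>k<m. real (card (?B' k)))" by (rule of_nat_sum)
  also have "\<dots> \<le> (\<Sum>k<m. exp (2 * D / (b * m) - w / b) * real m ^ card J)"
    by (intro sum_mono one) simp
  finally show ?thesis by simp
qed

text \<open>Counting over the hash first and then over the signs is conditioning on the hash.\<close>

lemma card_product_filter_le:
  assumes H: "finite H" and S: "finite S"
    and bad: "real (card {h \<in> H. Q h}) \<le> p1 * real (card H)"
    and good: "\<And>h. h \<in> H \<Longrightarrow> \<not> Q h \<Longrightarrow> real (card {s \<in> S. P h s}) \<le> p2 * real (card S)"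
    and p2: "0 \<le> p2"
  shows "real (card {(h, s) \<in> H \<times> S. P h s}) \<le> (p1 + p2) * real (card (H \<times> S))"
proof -
  let ?G = "Sigma {h \<in> H. \<not> Q h} (\<lambda>h. {s \<in> S. P h s})"
  have "{(h, s) \<in> H \<times> S. P h s} \<subseteq> {h \<in> H. Q h} \<times> S \<union> ?G" by auto
  then have "card {(h, s) \<in> H \<times> S. P h s} \<le> card ({h \<in> H. Q h} \<times> S \<union> ?G)"
    using H S by (intro card_mono) auto
  also have "\<dots> \<le> card ({h \<in> H. Q h} \<times> S) + card ?G" by (rule card_Un_le)
  finally have "real (card {(h, s) \<in> H \<times> S. P h s}) \<le> real (card ({h \<in> H. Q h} \<times> S)) + real (card ?G)"
    by linarith
  also have "real (card ({h \<in> H. Q h} \<times> S)) \<le> p1 * real (card H) * real (card S)"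
    unfolding card_cartesian_product of_nat_mult using bad by (intro mult_right_mono) auto
  also have "real (card ?G) = (\<Sum>h\<in>{h \<in> H. \<not> Q h}. real (card {s \<in> S. P h s}))"
    using H S by (subst card_SigmaI) auto
  also have "\<dots> \<le> (\<Sum>h\<in>{h \<in> H. \<not> Q h}. p2 * real (card S))"
    using good by (intro sum_mono) auto
  also have "\<dots> \<le> (\<Sum>h\<in>H. p2 * real (card S))"
    using H p2 by (intro sum_mono2) auto
  finally show ?thesis by (simp add: card_cartesian_product algebra_simps)
qed

text \<open>The load bound is used with b = \<epsilon>/d, the leverage bound outside
  \<open>I\<close>, and D = d, the bound on the total leverage. The threshold w stays free: raising
  it shrinks the hash term and enlarges the sign term.\<close>

lemma countsketch_failure:
  assumes I: "I \<subseteq> {0..<n}" and lev: "{i. i < n \<and> leverage n d A i \<ge> \<epsilon> / real d} \<subseteq> I"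
    and e: "0 < \<epsilon>" "\<epsilon> < 1" and d: "0 < d" and m: "0 < m" and w: "0 < w"
  shows "measure_pmf.prob (countsketch_pmf n I m)
        {\<omega>. \<exists>x \<in> colspace n d A.
             \<bar>sqnorm_n (card I + m) (sketch_apply n I m \<omega> x) - sqnorm_n n x\<bar> > \<epsilon> * sqnorm_n n x}
      \<le> real m * exp (2 * (real d)\<^sup>2 / (\<epsilon> * m) - w * real d / \<epsilon>)
        + 2 * real d * exp (- (\<epsilon>\<^sup>2 / (1280 * w)))"  (is "measure_pmf.prob _ ?E \<le> ?p1 + ?p2")
proof -
  define J where "J = {0..<n} - I"
  have J: "finite J" by (simp add: J_def)
  obtain r q where r: "r \<le> d" and q: "orthonormal n r q" and q0: "\<forall>k<r. \<forall>i\<ge>n. q k i = 0"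
    and col: "colspace n d A = combs r q" using colspace_orthonormal_basis by blast
  define u where "u = (\<lambda>i k. q k i)"
  define t where "t i = inner_n r (u i) (u i)" for i
  have t0: "0 \<le> t i" for i by (simp add: t_def inner_n_nonneg)
  have tb: "t i \<le> \<epsilon> / d" if "i \<in> J" for i
  proof -
    have "t i = leverage n d A i"
      using that leverage_eq[OF q q0 col, of i] by (simp add: J_def t_def u_def inner_n_def power2_eq_square)
    then show ?thesis using lev that by (force simp: J_def)
  qed
  have "(\<Sum>i\<in>J. t i) \<le> (\<Sum>i<n. t i)"
    using t0 by (intro sum_mono2) (auto simp: J_def)
  also have "\<dots> = real r"
    using sum_sq_orthonormal[OF q] by (simp add: t_def u_def inner_n_def power2_eq_square)
  also have "\<dots> \<le> real d" using r by simp
  finally have tsum: "(\<Sum>i\<in>J. t i) \<le> real d" .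
  have iso: "(\<Sum>i\<in>J. (inner_n r (u i) c)\<^sup>2) \<le> inner_n r c c" for c
  proof -
    define x where "x = (\<lambda>i. \<Sum>k<r. c k * q k i)"
    have "(\<Sum>i\<in>J. (inner_n r (u i) c)\<^sup>2) = (\<Sum>i\<in>J. (x i)\<^sup>2)"
      by (simp add: x_def u_def inner_n_def mult.commute)
    also have "\<dots> \<le> sqnorm_n n x"
      unfolding sqnorm_n_def by (intro sum_mono2) (auto simp: J_def)
    also have "\<dots> = inner_n r c c" by (rule sketch_distortion(1)[OF q I x_def])
    finally show ?thesis .
  qed
  let ?H = "PiE J (\<lambda>_. {0..<m})"
  define P where "P h \<sigma> \<longleftrightarrow> (\<exists>c. \<epsilon> * inner_n r c c <
      \<bar>(\<Sum>k<m. (inner_n r (comb (bucket J h k) u \<sigma>) c)\<^sup>2) - (\<Sum>i\<in>J. (inner_n r (u i) c)\<^sup>2)\<bar>)" for h \<sigma>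
  have fH: "finite ?H" using J by (intro finite_PiE) auto
  have space: "cs_space n I m = ?H \<times> signs J" by (simp add: cs_space_def signs_def J_def)
  have EP: "(h, \<sigma>) \<in> ?E \<longleftrightarrow> P h \<sigma>" for h \<sigma>
  proof -
    define X where "X c = (\<lambda>i. \<Sum>k<r. c k * q k i)" for c
    note dist = sketch_distortion[OF q I X_def, folded u_def J_def]
    have "(h, \<sigma>) \<in> ?E \<longleftrightarrow> (\<exists>c. \<epsilon> * sqnorm_n n (X c)
      < \<bar>sqnorm_n (card I + m) (sketch_apply n I m (h, \<sigma>) (X c)) - sqnorm_n n (X c)\<bar>)"
      by (simp add: col combs_def X_def)
    also have "\<dots> \<longleftrightarrow> P h \<sigma>"
      unfolding P_def dist(2) unfolding dist(1) by (simp add: u_def)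
    finally show ?thesis .
  qed
  have "real (card {(h, \<sigma>) \<in> ?H \<times> signs J. P h \<sigma>}) \<le> (?p1 + ?p2) * real (card (?H \<times> signs J))"
  proof (rule card_product_filter_le[OF fH finite_signs[OF J], where Q = "\<lambda>h. \<exists>k<m. w < (\<Sum>i\<in>bucket J h k. t i)"])
    have "real (card {h \<in> ?H. \<exists>k<m. w < (\<Sum>i\<in>bucket J h k. t i)})
      \<le> real m * exp (2 * real d / (\<epsilon> / d * m) - w / (\<epsilon> / d)) * real m ^ card J"
      using e d by (intro hash_load_tail[OF J m _ _ tsum]) (auto simp: t0 tb)
    then show "real (card {h \<in> ?H. \<exists>k<m. w < (\<Sum>i\<in>bucket J h k. t i)}) \<le> ?p1 * real (card ?H)"
      using J by (simp add: card_PiE power2_eq_square mult.assoc)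
  next
    fix h assume h: "h \<in> ?H" and good: "\<not> (\<exists>k<m. w < (\<Sum>i\<in>bucket J h k. t i))"
    have hm: "h i < m" if "i \<in> J" for i using h that by (auto simp: PiE_def Pi_def)
    have load: "(\<Sum>i\<in>bucket J h k. inner_n r (u i) (u i)) \<le> w" for k
    proof (cases "k < m")
      case True
      then show ?thesis using good by (force simp: t_def)
    next
      case False
      then have "bucket J h k = {}" using hm by (auto simp: bucket_def)
      then show ?thesis using w by simp
    qed
    have "real (card {\<sigma> \<in> signs J. P h \<sigma>}) \<le> 2 * real r * exp (- (\<epsilon>\<^sup>2 / (1280 * w))) * 2 ^ card J"
      unfolding P_def by (rule sketch_tail[OF J hm w load iso e])
    also have "\<dots> \<le> ?p2 * 2 ^ card J" using r by (intro mult_right_mono) auto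
    finally show "real (card {\<sigma> \<in> signs J. P h \<sigma>}) \<le> ?p2 * real (card (signs J))"
      using J by (simp add: card_signs)
  qed simp
  moreover have "cs_space n I m \<inter> ?E = {(h, \<sigma>) \<in> ?H \<times> signs J. P h \<sigma>}"
    unfolding space using EP by auto
  moreover have "cs_space n I m \<noteq> {}" "finite (cs_space n I m)"
    using J m fH finite_signs[OF J] by (auto simp: space signs_def PiE_eq_empty_iff)
  moreover from this have "0 < real (card (cs_space n I m))" by (simp add: card_gt_0_iff)
  ultimately show ?thesis
    by (simp add: countsketch_pmf_def measure_pmf_of_set pos_divide_le_eq space)
qed

section \<open>Choice of the parameters\<close>

theorem mainTheorem2:
  "\<exists>C :: real. \<exists>k :: nat. C > 0 \<and>
    (\<forall>(n::nat) (d::nat) (A :: nat \<Rightarrow> nat \<Rightarrow> real) (\<epsilon>::real) (\<delta>::real) (m::nat) (I :: nat set).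
      0 < \<epsilon> \<and> \<epsilon> < 1 \<and>
      I \<subseteq> {0..<n} \<and>
      {i. i < n \<and> leverage n d A i \<ge> \<epsilon> / real d} \<subseteq> I \<and>
      real m \<ge> C * (real d / \<epsilon>\<^sup>2) * ((1 + ln (1 / \<epsilon>)) ^ k + ln (1 / \<delta>)) \<and>
      0 < \<delta> \<and> \<delta> \<le> 1 / real m \<and>
      real d \<ge> C * (1 / \<epsilon>) * (1 + ln (1 / \<epsilon>)) ^ k * (ln (1 / \<delta>))\<^sup>2
    \<longrightarrow>
      measure_pmf.prob (countsketch_pmf n I m)
        {\<omega>. \<exists>x \<in> colspace n d A.
             \<bar>sqnorm_n (card I + m) (sketch_apply n I m \<omega> x) - sqnorm_n n x\<bar> > \<epsilon> * sqnorm_n n x}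
      \<le> \<delta>)"
\<comment> \<open>40960 = 8 * 5120, with 5120 taken from w below: the condition on m keeps the
  mean-load term of the hash tail below a quarter of w d / \<epsilon>, and the condition on d makes
  that quarter at least 2 L. The degree of the polylog is 0 because neither tail bound contains ln
  (1 / \<epsilon>).\<close>
proof (rule exI[of _ 40960], rule exI[of _ 0], intro conjI allI impI; (elim conjE)?)
  fix n d :: nat and A :: "nat \<Rightarrow> nat \<Rightarrow> real" and \<epsilon> \<delta> :: real and m :: nat and I :: "nat set"
  assume e: "0 < \<epsilon>" "\<epsilon> < 1" and I: "I \<subseteq> {0..<n}"
    and lev: "{i. i < n \<and> leverage n d A i \<ge> \<epsilon> / real d} \<subseteq> I"
    and mC: "40960 * (real d / \<epsilon>\<^sup>2) * ((1 + ln (1 / \<epsilon>)) ^ 0 + ln (1 / \<delta>)) \<le> real m"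
    and \<delta>: "0 < \<delta>" "\<delta> \<le> 1 / real m"
    and dC: "40960 * (1 / \<epsilon>) * (1 + ln (1 / \<epsilon>)) ^ 0 * (ln (1 / \<delta>))\<^sup>2 \<le> real d"
  let ?p = "measure_pmf.prob (countsketch_pmf n I m)
        {\<omega>. \<exists>x \<in> colspace n d A.
             \<bar>sqnorm_n (card I + m) (sketch_apply n I m \<omega> x) - sqnorm_n n x\<bar> > \<epsilon> * sqnorm_n n x}"
  show "?p \<le> \<delta>"
  proof (cases "\<delta> < 1")
    case False
    then show ?thesis using measure_pmf.prob_le_1 by (meson not_le order_trans less_imp_le)
  next
    case True
    define L where "L = ln (1 / \<delta>)"
    have L: "0 < L" using \<delta> True by (simp add: L_def)
    have eL: "exp (- L) = \<delta>" using \<delta> by (simp add: L_def ln_div)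
    \<comment> \<open>\<open>1 / real 0\<close> is 0, so m = 0 would contradict 0 <
      \<delta>.\<close>
    have m: "0 < m" using \<delta> by (cases "m = 0") auto
    have dL: "40960 * L\<^sup>2 \<le> \<epsilon> * real d" using dC e by (simp add: L_def field_simps)
    have d: "0 < d" using dL L by (cases "d = 0") auto
    have mL: "40960 * real d * (1 + L) \<le> real m * \<epsilon>\<^sup>2"
      using mC e by (simp add: L_def field_simps)
    have m\<delta>: "real m * \<delta> \<le> 1" using \<delta>(2) m by (simp add: field_simps)
    have "\<epsilon>\<^sup>2 \<le> 1" using e by (simp add: power_le_one)
    then have "real m * \<epsilon>\<^sup>2 \<le> real m" by (simp add: mult_left_le)
    moreover have "40960 * real d * 1 \<le> 40960 * real d * (1 + L)" using L by (intro mult_left_mono) auto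
    ultimately have dm: "40960 * real d \<le> real m" using mL by simp
    have d\<delta>: "real d * \<delta> \<le> 1"
      using mult_right_mono[of "real d" "real m" \<delta>] dm m\<delta> \<delta> by linarith
    have half: "\<delta> \<le> 1 / 2"
    proof -
      have "2 * \<delta> \<le> real m * \<delta>" using dm d \<delta> by (intro mult_right_mono) auto
      then show ?thesis using m\<delta> by simp
    qed
    \<comment> \<open>With this w the sign tail is exactly exp(-4 L) = \<delta>^4, apart from its
      prefactor.\<close>
    define w where "w = \<epsilon>\<^sup>2 / (5120 * L)"
    have w: "0 < w" using e L by (simp add: w_def)
    have x1: "2 * (real d)\<^sup>2 / (\<epsilon> * m) - w * real d / \<epsilon> \<le> - (4 * L)"
    proof -
      have "real d * (40960 * L) \<le> real m * \<epsilon>\<^sup>2" using mL d by (simp add: algebra_simps)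
      then have "real d / m \<le> \<epsilon>\<^sup>2 / (40960 * L)" using m L by (simp add: field_simps)
      then have "2 * real d / \<epsilon> * (real d / m) \<le> 2 * real d / \<epsilon> * (\<epsilon>\<^sup>2 / (40960 * L))"
        using e by (intro mult_left_mono) auto
      also have "\<dots> = \<epsilon> * real d / (20480 * L)" using e by (simp add: power2_eq_square)
      finally have a: "2 * (real d)\<^sup>2 / (\<epsilon> * m) \<le> \<epsilon> * real d / (20480 * L)"
        by (simp add: power2_eq_square)
      have "w * real d / \<epsilon> = 4 * (\<epsilon> * real d / (20480 * L))"
        using e by (simp add: w_def power2_eq_square)
      moreover have "2 * L \<le> \<epsilon> * real d / (20480 * L)"
        using dL L by (simp add: pos_le_divide_eq power2_eq_square)
      ultimately show ?thesis using a L by linarith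
    qed
    have x2: "\<epsilon>\<^sup>2 / (1280 * w) = 4 * L" using e L by (simp add: w_def)
    have e4: "exp (- (4 * L)) = \<delta> ^ 4"
      using exp_of_nat_mult[of 4 "- L"] by (simp add: eL)
    have "?p \<le> real m * exp (2 * (real d)\<^sup>2 / (\<epsilon> * m) - w * real d / \<epsilon>)
        + 2 * real d * exp (- (\<epsilon>\<^sup>2 / (1280 * w)))"
      by (rule countsketch_failure[OF I lev e d m w])
    also have "\<dots> \<le> real m * \<delta> ^ 4 + 2 * real d * \<delta> ^ 4"
      unfolding x2 e4[symmetric] using x1 by (intro add_mono mult_left_mono) auto
    \<comment> \<open>Of the four powers of \<delta>, one absorbs the prefactor m or d, two absorb
      the constant 3 because \<delta> <= 1/2, and one remains.\<close>
    also have "\<dots> = (real m * \<delta> + 2 * (real d * \<delta>)) * \<delta> ^ 3"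
      by (simp add: algebra_simps power_numeral_reduce)
    also have "\<dots> \<le> 3 * \<delta> ^ 3" using m\<delta> d\<delta> \<delta> by (intro mult_right_mono) auto
    also have "\<dots> = 3 * \<delta>\<^sup>2 * \<delta>" by (simp add: power_numeral_reduce)
    also have "\<dots> \<le> 1 * \<delta>"
    proof (rule mult_right_mono)
      have "\<delta>\<^sup>2 \<le> (1 / 2)\<^sup>2" using half \<delta> by (intro power_mono) auto
      then show "3 * \<delta>\<^sup>2 \<le> 1" by (simp add: power2_eq_square)
    qed (use \<delta> in simp)
    finally show ?thesis by simp
  qed
qed simp

end
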